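(* Let $0<\alpha<1$ and $\beta\ge0$. Assume $f\in L^1_{\mathrm{loc}}(0,\infty)$ and that $u:={}^{W}I_t^{\alpha,\beta}f$ is locally absolutely continuous with $u(0)=0$. Then $${}^{W}D_t^{\alpha,\beta}u(t)=f(t)\quad\text{for almost every }t>0.$$
   Context: Let $\Phi_{\alpha,\beta}(s)=s^\alpha\bigl(1+(1-\alpha)s^{\alpha-1}\bigr)^{-\beta}$ (principal branches). $L^1_{\mathrm{loc}}(0,\infty)$ means integrable on $(0,T)$ for every finite $T>0$. The $W$-fractional integral is $({}^{W}I_t^{\alpha,\beta}f)(t)=\int_0^tk_{\alpha,\beta}(t-s)f(s)\,ds$, $t>0$, whenever the convolution is finite, where $k_{\alpha,\beta}\in L^1_{\mathrm{loc}}(0,\infty)$ is the kernel with Laplace transform $\mathcal{L}[k_{\alpha,\beta}](s)=1/\Phi_{\alpha,\beta}(s)$ for $\Re s>0$; explicitly $k_{\alpha,\beta}(t)=t^{\alpha-1}E^{-\beta}_{1-\alpha,\alpha}\bigl(-(1-\alpha)t^{1-\alpha}\bigr)$, with the Prabhakar function $E^\gamma_{\rho,\delta}(z)=\sum_{n\ge0}\frac{(\gamma)_n}{n!\,\Gamma(\rho n+\delta)}z^n$, $(\gamma)_n=\gamma(\gamma+1)\cdots(\gamma+n-1)$. The $W$-fractional derivative ${}^{W}D_t^{\alpha,\beta}u$ is defined, for sufficiently regular $u$, through the Laplace transform by $\mathcal{L}[{}^{W}D_t^{\alpha,\beta}u](s)=\Phi_{\alpha,\beta}(s)\widehat u(s)-\frac{\Phi_{\alpha,\beta}(s)}{s}u(0)$,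 $\Re s>0$. For locally absolutely continuous $u$ on $[0,\infty)$ this is understood in the equivalent Volterra form ${}^{W}D_t^{\alpha,\beta}u(t)=\int_0^tw_{\alpha,\beta}(t-s)u'(s)\,ds$ (for a.e. $t$), where $w_{\alpha,\beta}\in L^1_{\mathrm{loc}}(0,\infty)$ is determined by $\mathcal{L}[w_{\alpha,\beta}](s)=\Phi_{\alpha,\beta}(s)/s$, $\Re s>0$. *)

theory Defs
  imports "HOL-Analysis.Analysis"
begin

definition L1_loc :: "(real \<Rightarrow> 'a::euclidean_space) \<Rightarrow> bool" where
  "L1_loc f \<longleftrightarrow> (\<forall>T>0. f absolutely_integrable_on {0<..<T})"

definition abs_continuous_on_interval ::
    "real \<Rightarrow> real \<Rightarrow> (real \<Rightarrow> 'a::real_normed_vector) \<Rightarrow> bool" where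
  "abs_continuous_on_interval a b u \<longleftrightarrow>
     (\<forall>\<epsilon>>0. \<exists>\<delta>>0. \<forall>(n::nat) x y.
        (\<forall>i<n. a \<le> x i \<and> x i \<le> y i \<and> y i \<le> b) \<and>
        disjoint_family_on (\<lambda>i. {x i<..<y i}) {..<n} \<and>
        (\<Sum>i<n. y i - x i) < \<delta>
        \<longrightarrow> (\<Sum>i<n. norm (u (y i) - u (x i))) < \<epsilon>)"

definition locally_abs_continuous :: "(real \<Rightarrow> 'a::real_normed_vector) \<Rightarrow> bool" where
  "locally_abs_continuous u \<longleftrightarrow> (\<forall>T>0. abs_continuous_on_interval 0 T u)"

text \<open>The convolution on the half-line. A divergent Bochner integral has the value 0; for
  \<open>k\<close> and \<open>f\<close> locally integrable the integral converges for almost every \<open>t > 0\<close>.\<close>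

definition half_line_convolution ::
    "(real \<Rightarrow> real) \<Rightarrow> (real \<Rightarrow> 'a::euclidean_space) \<Rightarrow> real \<Rightarrow> 'a" where
  "half_line_convolution k f t = (LINT s:{0<..<t}|lebesgue. k (t - s) *\<^sub>R f s)"

definition has_laplace_transform :: "(real \<Rightarrow> real) \<Rightarrow> (complex \<Rightarrow> complex) \<Rightarrow> bool" where
  "has_laplace_transform w F \<longleftrightarrow>
     (\<forall>s. Re s > 0 \<longrightarrow>
        (\<lambda>t. exp (- (s * of_real t)) * of_real (w t)) absolutely_integrable_on {0<..} \<and>
        (LINT t:{0<..}|lebesgue. exp (- (s * of_real t)) * of_real (w t)) = F s)"

definition W_symbol :: "real \<Rightarrow> real \<Rightarrow> complex \<Rightarrow> complex" where
  "W_symbol \<alpha> \<beta> s =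
     s powr of_real \<alpha> *
     (1 + of_real (1 - \<alpha>) * s powr of_real (\<alpha> - 1)) powr of_real (- \<beta>)"

text \<open>The Prabhakar function $E^\gamma_{\rho,\delta}$.\<close>

definition prabhakar :: "real \<Rightarrow> real \<Rightarrow> real \<Rightarrow> real \<Rightarrow> real" where
  "prabhakar \<gamma> \<rho> \<delta> z =
     (\<Sum>n. pochhammer \<gamma> n / (fact n * Gamma (\<rho> * real n + \<delta>)) * z ^ n)"

definition W_integral_kernel :: "real \<Rightarrow> real \<Rightarrow> real \<Rightarrow> real" where
  "W_integral_kernel \<alpha> \<beta> t =
     t powr (\<alpha> - 1) *
     prabhakar (- \<beta>) (1 - \<alpha>) \<alpha> (- (1 - \<alpha>) * t powr (1 - \<alpha>))"

definition W_integral ::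
    "real \<Rightarrow> real \<Rightarrow> (real \<Rightarrow> 'a::euclidean_space) \<Rightarrow> real \<Rightarrow> 'a" where
  "W_integral \<alpha> \<beta> f = half_line_convolution (W_integral_kernel \<alpha> \<beta>) f"

text \<open>The kernel of the derivative is characterised only up to null sets, by its Laplace
  transform; therefore it is a parameter of the derivative.\<close>

definition is_W_derivative_kernel :: "real \<Rightarrow> real \<Rightarrow> (real \<Rightarrow> real) \<Rightarrow> bool" where
  "is_W_derivative_kernel \<alpha> \<beta> w \<longleftrightarrow>
     L1_loc w \<and> has_laplace_transform w (\<lambda>s. W_symbol \<alpha> \<beta> s / s)"

definition W_derivative ::
    "(real \<Rightarrow> real) \<Rightarrow> (real \<Rightarrow> 'a::euclidean_space) \<Rightarrow> real \<Rightarrow> 'a" where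
  "W_derivative w u = half_line_convolution w (\<lambda>s. vector_derivative u (at s))"

end

theory Submission
  imports Defs
begin

text \<open>
  For real \<open>x \<ge> 1\<close> the Laplace transform of the kernel \<open>k\<close> of the integral is computed termwise from the
  binomial series; it is the reciprocal of \<open>x\<close> times the transform of \<open>w\<close>. By Lerch's uniqueness
  theorem \<open>w * k = 1\<close> almost everywhere. An absolutely continuous \<open>u\<close> with \<open>u 0 = 0\<close> is \<open>1 * u'\<close>.
  Hence \<open>1 * (w * u') = w * (1 * u') = w * u = w * (k * f) = 1 * f\<close>, and \<open>w * u' = f\<close> follows by
  Lebesgue's differentiation theorem. All convolutions are taken in \<open>L\<^sup>1\<close>, after cutting the functions
  off outside a bounded interval \<open>(0, T)\<close>.
\<close>

section \<open>Convolution of integrable functions\<close>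

definition lborel_convolution :: "(real \<Rightarrow> real) \<Rightarrow> (real \<Rightarrow> 'a::euclidean_space) \<Rightarrow> real \<Rightarrow> 'a" where
  "lborel_convolution a F t = (LINT s|lborel. a (t - s) *\<^sub>R F s)"

lemma integral_scaleR_right_zero:
  fixes F :: "_ \<Rightarrow> 'a::euclidean_space"
  shows "(LINT s|M. c *\<^sub>R F s) = c *\<^sub>R (LINT s|M. F s)"
proof (cases "c = 0")
  case False
  then show ?thesis
    by (intro integral_bounded_linear'[where T'="\<lambda>x. x /\<^sub>R c"] bounded_linear_scaleR_right) auto
qed simp

lemma integral_scaleR_left_zero:
  fixes v :: "'a::euclidean_space"
  shows "(LINT s|M. c s *\<^sub>R v) = (LINT s|M. c s) *\<^sub>R v"
proof (cases "v = 0")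
  case False
  then show ?thesis
    by (intro integral_bounded_linear'[where T'="\<lambda>x. (x \<bullet> v) / (v \<bullet> v)"]
        bounded_linear_scaleR_left bounded_linear_divide bounded_linear_compose[OF bounded_linear_divide]
        bounded_linear_inner_left) auto
qed simp

lemma integral_lborel_reflect:
  fixes F :: "real \<Rightarrow> 'a::euclidean_space"
  shows "(LINT s|lborel. F (t - s)) = (LINT s|lborel. F s)"
  using lborel_integral_real_affine[of "-1" F t] by simp

lemma integral_lborel_translate:
  fixes F :: "real \<Rightarrow> 'a::euclidean_space"
  shows "(LINT s|lborel. F (s - t)) = (LINT s|lborel. F s)"
  using lborel_integral_real_affine[of "1" F "-t"] by simp

lemma integrable_lborel_translate:
  fixes F :: "real \<Rightarrow> 'a::euclidean_space"
  assumes "integrable lborel F"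
  shows "integrable lborel (\<lambda>s. F (s - t))"
  using lborel_integrable_real_affine[of F "1" "-t"] assms by simp

lemma integrable_pair_convolution:
  fixes F :: "real \<Rightarrow> 'a::euclidean_space"
  assumes a: "integrable lborel a" and F: "integrable lborel F"
  shows "integrable (lborel \<Otimes>\<^sub>M lborel) (\<lambda>(s, t). a (t - s) *\<^sub>R F s)"
proof -
  have [measurable]: "a \<in> borel_measurable borel" "F \<in> borel_measurable borel"
    using a F by (auto dest: borel_measurable_integrable)
  have 1: "integrable lborel (\<lambda>t. a (t - s) *\<^sub>R F s)" for s
    by (intro integrable_scaleR_left integrable_lborel_translate a)
  have "(\<lambda>s. LINT t|lborel. norm (a (t - s) *\<^sub>R F s)) = (\<lambda>s. (LINT t|lborel. \<bar>a t\<bar>) * norm (F s))"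
    using integral_lborel_translate[of "\<lambda>t. \<bar>a t\<bar>"] by (simp add: fun_eq_iff)
  then have 2: "integrable lborel (\<lambda>s. LINT t|lborel. norm (a (t - s) *\<^sub>R F s))"
    using F by simp
  show ?thesis
    by (rule lborel_pair.Fubini_integrable) (use 1 2 in \<open>simp_all add: split_beta\<close>)
qed

lemma
  fixes F :: "real \<Rightarrow> 'a::euclidean_space"
  assumes a: "integrable lborel a" and F: "integrable lborel F"
  shows AE_integrable_lborel_convolution:
      "AE t in lborel. integrable lborel (\<lambda>s. a (t - s) *\<^sub>R F s)"
    and integrable_lborel_convolution: "integrable lborel (lborel_convolution a F)"
    and integral_lborel_convolution:
      "integral\<^sup>L lborel (lborel_convolution a F) = integral\<^sup>L lborel a *\<^sub>R integral\<^sup>L lborel F"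
proof -
  note I = integrable_pair_convolution[OF a F]
  show "AE t in lborel. integrable lborel (\<lambda>s. a (t - s) *\<^sub>R F s)"
    using lborel_pair.AE_integrable_snd[OF I] .
  show "integrable lborel (lborel_convolution a F)"
    using lborel_pair.integrable_snd[OF I] unfolding lborel_convolution_def .
  have "integral\<^sup>L lborel (lborel_convolution a F) = (LINT s|lborel. LINT t|lborel. a (t - s) *\<^sub>R F s)"
    unfolding lborel_convolution_def using lborel_pair.Fubini_integral[OF I] .
  also have "\<dots> = (LINT s|lborel. integral\<^sup>L lborel a *\<^sub>R F s)"
    using integral_lborel_translate[of a] by (simp add: integral_scaleR_left_zero)
  also have "\<dots> = integral\<^sup>L lborel a *\<^sub>R integral\<^sup>L lborel F"
    by (rule integral_scaleR_right_zero)
  finally show "integral\<^sup>L lborel (lborel_convolution a F) = integral\<^sup>L lborel a *\<^sub>R integral\<^sup>L lborel F" .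
qed

lemma lborel_convolution_commute:
  "lborel_convolution a b = lborel_convolution b a" for a b :: "real \<Rightarrow> real"
proof
  fix t show "lborel_convolution a b t = lborel_convolution b a t"
    using integral_lborel_reflect[of "\<lambda>s. a (t - s) *\<^sub>R b s" t]
    by (simp add: lborel_convolution_def mult.commute)
qed

lemma lborel_convolution_assoc:
  fixes F :: "real \<Rightarrow> 'a::euclidean_space"
  assumes a: "integrable lborel a" and b: "integrable lborel b" and F: "integrable lborel F"
  shows "AE t in lborel. lborel_convolution (lborel_convolution a b) F t =
    lborel_convolution a (lborel_convolution b F) t"
proof -
  have [measurable]: "a \<in> borel_measurable borel" "b \<in> borel_measurable borel"
      "F \<in> borel_measurable borel"
    using a b F by (auto dest: borel_measurable_integrable)
  define D where "D = lborel_convolution (\<lambda>t. \<bar>b t\<bar>) (\<lambda>s. norm (F s))"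
  have D: "integrable lborel D"
    unfolding D_def using b F by (intro integrable_lborel_convolution) auto
  have "AE t in lborel. integrable lborel (\<lambda>s. \<bar>a (t - s)\<bar> *\<^sub>R D s)"
    using a by (intro AE_integrable_lborel_convolution[OF _ D]) auto
  moreover have "lborel_convolution (lborel_convolution a b) F t =
      lborel_convolution a (lborel_convolution b F) t"
    if t: "integrable lborel (\<lambda>s. \<bar>a (t - s)\<bar> *\<^sub>R D s)" for t
  proof -
    have I: "integrable (lborel \<Otimes>\<^sub>M lborel) (\<lambda>(s, r). a (t - s) *\<^sub>R b (s - r) *\<^sub>R F r)"
    proof (rule lborel_pair.Fubini_integrable)
      show "(\<lambda>(s, r). a (t - s) *\<^sub>R b (s - r) *\<^sub>R F r) \<in> borel_measurable (lborel \<Otimes>\<^sub>M lborel)"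
        by simp
      show "AE s in lborel. integrable lborel (\<lambda>r. case (s, r) of (s, r) \<Rightarrow> a (t - s) *\<^sub>R b (s - r) *\<^sub>R F r)"
        using AE_integrable_lborel_convolution[OF b F]
      proof eventually_elim
        case (elim s)
        from integrable_scaleR_right[OF elim, of "a (t - s)"] show ?case by simp
      qed
      show "integrable lborel (\<lambda>s. LINT r|lborel. norm (case (s, r) of (s, r) \<Rightarrow> a (t - s) *\<^sub>R b (s - r) *\<^sub>R F r))"
        using t by (simp add: D_def lborel_convolution_def abs_mult mult.assoc)
    qed
    have "lborel_convolution a (lborel_convolution b F) t =
        (LINT s|lborel. LINT r|lborel. a (t - s) *\<^sub>R b (s - r) *\<^sub>R F r)"
      unfolding lborel_convolution_def integral_scaleR_right_zero ..
    also have "\<dots> = (LINT r|lborel. LINT s|lborel. a (t - s) *\<^sub>R b (s - r) *\<^sub>R F r)"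
      using lborel_pair.Fubini_integral[OF I] by simp
    also have "\<dots> = (LINT r|lborel. lborel_convolution a b (t - r) *\<^sub>R F r)"
    proof (intro Bochner_Integration.integral_cong refl)
      fix r
      have "(LINT s|lborel. a (t - s) *\<^sub>R b (s - r) *\<^sub>R F r) =
          (LINT s|lborel. a (t - s) *\<^sub>R b (s - r)) *\<^sub>R F r"
        using integral_scaleR_left_zero[of lborel "\<lambda>s. a (t - s) *\<^sub>R b (s - r)" "F r"] by simp
      also have "(LINT s|lborel. a (t - s) *\<^sub>R b (s - r)) = lborel_convolution a b (t - r)"
        using integral_lborel_translate[of "\<lambda>s. a (t - r - s) *\<^sub>R b s" r]
        by (simp add: lborel_convolution_def)
      finally show "(LINT s|lborel. a (t - s) *\<^sub>R b (s - r) *\<^sub>R F r) =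
          lborel_convolution a b (t - r) *\<^sub>R F r" .
    qed
    finally show ?thesis
      by (simp add: lborel_convolution_def)
  qed
  ultimately show ?thesis
    by (rule eventually_mono)
qed

section \<open>Differentiation of the indefinite integral\<close>

lemma AE_lborel_reflect:
  assumes "AE x in lborel. P x"
  shows "AE x::real in lborel. P (t - x)"
proof -
  have "AE x in distr lborel borel uminus. P (x::real)"
    unfolding lborel_distr_uminus by (rule assms)
  then have "AE x::real in lborel. P (- x)"
    by (rule AE_distrD[rotated]) simp
  then have "AE x in distr lborel borel ((+) (- t)). P (- x)"
    unfolding lborel_distr_plus .
  then have "AE x in lborel. P (- (- t + x))"
    by (rule AE_distrD[rotated]) simp
  then show ?thesis by simp
qed

lemma set_integral_greaterThanAtMost_diff:
  fixes G :: "real \<Rightarrow> 'a::euclidean_space"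
  assumes "integrable lborel G" "x \<le> y"
  shows "(LINT s:{..y}|lborel. G s) - (LINT s:{..x}|lborel. G s) = integral {x..y} G"
proof -
  have G: "set_integrable lborel A G" if "A \<in> sets lborel" for A
    using assms(1) that by (simp add: set_integrable_def integrable_mult_indicator)
  have "{..y} = {..x} \<union> {x<..y}" using assms by auto
  then have "(LINT s:{..y}|lborel. G s) = (LINT s:{..x}|lborel. G s) + (LINT s:{x<..y}|lborel. G s)"
    using G by (simp only:) (rule set_integral_Un, auto)
  also have "(LINT s:{x<..y}|lborel. G s) = (LINT s:{x..y}|lborel. G s)"
  proof (rule set_integral_cong_set)
    show "AE s in lborel. (s \<in> {x..y}) = (s \<in> {x<..y})"
      using AE_lborel_singleton[of x] by eventually_elim auto
  qed (use assms in \<open>auto simp: set_borel_measurable_def\<close>)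
  also have "\<dots> = integral {x..y} G"
    using G by (intro set_borel_integral_eq_integral) auto
  finally show ?thesis by simp
qed

lemma AE_right_derivative_integral:
  fixes G :: "real \<Rightarrow> 'a::euclidean_space"
  assumes "integrable lborel G"
  shows "AE x in lborel. \<forall>e>0. \<exists>d>0. \<forall>h. 0 < h \<and> h < d \<longrightarrow>
    norm (integral {x..x + h} G - h *\<^sub>R G x) \<le> e * h"
proof -
  have int: "G integrable_on cbox a b" for a b
    by (rule integrable_on_subcbox[OF integrable_on_lborel[OF assms]]) auto
  obtain N where N: "negligible N"
    "\<And>x e. \<lbrakk>x \<notin> N; 0 < e\<rbrakk> \<Longrightarrow> \<exists>d>0. \<forall>h. 0 < h \<and> h < d \<longrightarrow>
       norm (integral (cbox x (x + h *\<^sub>R One)) G /\<^sub>R h ^ DIM(real) - G x) < e"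
    by (rule integrable_ccontinuous_explicit[OF int]) (rule that)
  have "AE x in lebesgue. x \<notin> N"
    using N(1) by (simp add: AE_not_in negligible_iff_null_sets)
  then have "AE x in lborel. x \<notin> N"
    by (simp add: AE_completion_iff)
  then show ?thesis
  proof eventually_elim
    case (elim x)
    show ?case
    proof (intro allI impI)
      fix e :: real assume e: "e > 0"
      obtain d where d: "d > 0" "\<And>h. 0 < h \<Longrightarrow> h < d \<Longrightarrow> norm (integral {x..x + h} G /\<^sub>R h - G x) < e"
        using N(2)[OF elim e] by auto
      have "norm (integral {x..x + h} G - h *\<^sub>R G x) \<le> e * h" if "0 < h" "h < d" for h
      proof -
        have "integral {x..x + h} G - h *\<^sub>R G x = h *\<^sub>R (integral {x..x + h} G /\<^sub>R h - G x)"
          using that by (simp add: scaleR_diff_right)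
        then show ?thesis
          using d(2)[OF that] that by (simp add: mult.commute)
      qed
      with d(1) show "\<exists>d>0. \<forall>h. 0 < h \<and> h < d \<longrightarrow> norm (integral {x..x + h} G - h *\<^sub>R G x) \<le> e * h"
        by blast
    qed
  qed
qed

theorem AE_has_vector_derivative_integral:
  fixes G :: "real \<Rightarrow> 'a::euclidean_space"
  assumes "integrable lborel G"
  shows "AE x in lborel. ((\<lambda>t. LINT s:{..t}|lborel. G s) has_vector_derivative G x) (at x)"
proof -
  let ?I = "\<lambda>t. LINT s:{..t}|lborel. G s"
  have "integrable lborel (\<lambda>x. G (- x))"
    using lborel_integrable_real_affine[OF assms, of "-1" 0] by simp
  from AE_lborel_reflect[OF AE_right_derivative_integral[OF this], of 0]
  have "AE x in lborel. \<forall>e>0. \<exists>d>0. \<forall>h. 0 < h \<and> h < d \<longrightarrow>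
      norm (integral {x - h..x} G - h *\<^sub>R G x) \<le> e * h"
  proof eventually_elim
    case (elim x)
    have "integral {- x..- x + h} (\<lambda>x. G (- x)) = integral {x - h..x} G" for h
      using Henstock_Kurzweil_Integration.integral_reflect_real[of "x" "x - h" G] by simp
    with elim show ?case by simp
  qed
  with AE_right_derivative_integral[OF assms] show ?thesis
  proof eventually_elim
    case (elim x)
    show ?case
      unfolding has_vector_derivative_def has_derivative_at_alt
    proof (intro conjI allI impI bounded_linear_scaleR_left)
      fix e :: real assume e: "e > 0"
      then obtain d1 where d1: "d1 > 0" "\<And>h. 0 < h \<and> h < d1 \<Longrightarrow>
          norm (integral {x..x + h} G - h *\<^sub>R G x) \<le> e * h"
        using elim(1) by blast
      from e obtain d2 where d2: "d2 > 0" "\<And>h. 0 < h \<and> h < d2 \<Longrightarrow>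
          norm (integral {x - h..x} G - h *\<^sub>R G x) \<le> e * h"
        using elim(2) by blast
      have "norm (?I y - ?I x - (y - x) *\<^sub>R G x) \<le> e * norm (y - x)"
        if y: "norm (y - x) < min d1 d2" for y
      proof (cases y x rule: linorder_cases)
        case less
        have "?I y - ?I x - (y - x) *\<^sub>R G x = - (integral {x - (x - y)..x} G - (x - y) *\<^sub>R G x)"
          using set_integral_greaterThanAtMost_diff[OF assms, of y x] less
          by (simp add: algebra_simps)
        then show ?thesis
          using d2(2)[of "x - y"] less y by (simp only: norm_minus_cancel) auto
      next
        case greater
        have "?I y - ?I x - (y - x) *\<^sub>R G x = integral {x..x + (y - x)} G - (y - x) *\<^sub>R G x"
          using set_integral_greaterThanAtMost_diff[OF assms, of x y] greater by simp
        then show ?thesis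
          using d1(2)[of "y - x"] greater y by auto
      qed simp
      then show "\<exists>d>0. \<forall>y. norm (y - x) < d \<longrightarrow> norm (?I y - ?I x - (y - x) *\<^sub>R G x) \<le> e * norm (y - x)"
        using d1 d2 by (metis min_less_iff_conj)
    qed
  qed
qed

lemma continuous_on_set_integral_atMost:
  fixes G :: "real \<Rightarrow> 'a::euclidean_space"
  assumes "integrable lborel G"
  shows "continuous_on {a..b} (\<lambda>t. LINT s:{..t}|lborel. G s)"
proof -
  have "G integrable_on {a..b}"
    by (rule integrable_on_subinterval[OF integrable_on_lborel[OF assms]]) auto
  then have "continuous_on {a..b} (\<lambda>t. (LINT s:{..a}|lborel. G s) + integral {a..t} G)"
    by (intro continuous_intros indefinite_integral_continuous_1)
  then show ?thesis
    by (rule continuous_on_eq) (simp flip: set_integral_greaterThanAtMost_diff[OF assms])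
qed

lemma AE_eq_0_if_AE_set_integral_eq_0:
  fixes G :: "real \<Rightarrow> 'a::euclidean_space"
  assumes G: "integrable lborel G"
    and 0: "AE t in lborel. t \<in> {a<..<b} \<longrightarrow> (LINT s:{..t}|lborel. G s) = 0"
  shows "AE t in lborel. t \<in> {a<..<b} \<longrightarrow> G t = 0"
proof -
  let ?I = "\<lambda>t. LINT s:{..t}|lborel. G s"
  have cont: "continuous_on {a<..<b} ?I"
    by (rule continuous_on_subset[OF continuous_on_set_integral_atMost[OF G, of a b]]) auto
  define Z where "Z = {a<..<b} \<inter> ?I -` (- {0})"
  have op: "open Z"
    unfolding Z_def by (intro continuous_open_preimage cont) auto
  have "Z \<in> null_sets lborel"
    using op by (subst AE_iff_null_sets) (auto simp: Z_def intro: eventually_mono[OF 0])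
  then have "Z = {}"
    using open_not_negligible[OF op] by (auto simp: negligible_iff_null_sets null_sets_completionI)
  then have I0: "?I t = 0" if "t \<in> {a<..<b}" for t
    using that by (auto simp: Z_def)
  show ?thesis
    using AE_has_vector_derivative_integral[OF G]
  proof eventually_elim
    case (elim x)
    show ?case
    proof
      assume x: "x \<in> {a<..<b}"
      have "((\<lambda>t. 0) has_vector_derivative G x) (at x)"
        by (rule has_vector_derivative_transform_within_open[OF elim _ x]) (use I0 in auto)
      then show "G x = 0"
        using vector_derivative_unique_at has_vector_derivative_const by blast
    qed
  qed
qed

section \<open>Absolutely continuous functions\<close>

definition ac_modulus :: "real \<Rightarrow> real \<Rightarrow> (real \<Rightarrow> real) \<Rightarrow> real \<Rightarrow> real \<Rightarrow> bool" where
  "ac_modulus a b u \<epsilon> \<delta> \<longleftrightarrow>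
     (\<forall>(n::nat) x y.
        (\<forall>i<n. a \<le> x i \<and> x i \<le> y i \<and> y i \<le> b) \<and>
        disjoint_family_on (\<lambda>i. {x i<..<y i}) {..<n} \<and>
        (\<Sum>i<n. y i - x i) < \<delta>
        \<longrightarrow> (\<Sum>i<n. \<bar>u (y i) - u (x i)\<bar>) < \<epsilon>)"

lemma ac_modulusD:
  assumes ac: "ac_modulus a b u \<epsilon> \<delta>" and fin: "finite I"
    and xy: "\<And>i. i \<in> I \<Longrightarrow> a \<le> x i \<and> x i \<le> y i \<and> y i \<le> b"
    and disj: "disjoint_family_on (\<lambda>i. {x i<..<y i}) I"
    and len: "(\<Sum>i\<in>I. y i - x i) < \<delta>"
  shows "(\<Sum>i\<in>I. \<bar>u (y i) - u (x i)\<bar>) < \<epsilon>"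
proof -
  obtain h where h: "bij_betw h {..<card I} I"
    using ex_bij_betw_nat_finite[OF fin] by (auto simp: atLeast0LessThan)
  have sum: "(\<Sum>i<card I. g (h i)) = sum g I" for g :: "_ \<Rightarrow> real"
    by (rule sum.reindex_bij_betw[OF h])
  have mem: "h i \<in> I" if "i < card I" for i
    using h that by (auto simp: bij_betw_def)
  have inj: "h i = h j \<longleftrightarrow> i = j" if "i < card I" "j < card I" for i j
    using h that by (auto simp: bij_betw_def inj_on_def)
  have "disjoint_family_on (\<lambda>i. {x (h i)<..<y (h i)}) {..<card I}"
    unfolding disjoint_family_on_def
  proof (intro ballI impI)
    fix i j assume "i \<in> {..<card I}" "j \<in> {..<card I}" "i \<noteq> j"
    then show "{x (h i)<..<y (h i)} \<inter> {x (h j)<..<y (h j)} = {}"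
      using disjoint_family_onD[OF disj, of "h i" "h j"] mem inj by auto
  qed
  then show ?thesis
    using ac[unfolded ac_modulus_def, rule_format, of "card I" "x \<circ> h" "y \<circ> h"] xy mem len
      sum[of "\<lambda>i. y i - x i"] sum[of "\<lambda>i. \<bar>u (y i) - u (x i)\<bar>"]
    by simp
qed

lemma abs_continuous_on_interval_iff_modulus:
  "abs_continuous_on_interval a b u \<longleftrightarrow> (\<forall>\<epsilon>>0. \<exists>\<delta>>0. ac_modulus a b u \<epsilon> \<delta>)"
  by (simp add: abs_continuous_on_interval_def ac_modulus_def)

lemma abs_continuous_imp_continuous_on:
  fixes u :: "real \<Rightarrow> real"
  assumes "abs_continuous_on_interval a b u"
  shows "continuous_on {a..b} u"
  unfolding continuous_on_iff
proof (intro ballI allI impI)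
  fix x e :: real assume x: "x \<in> {a..b}" and "e > 0"
  then obtain \<delta> where \<delta>: "\<delta> > 0" "ac_modulus a b u e \<delta>"
    using assms by (auto simp: abs_continuous_on_interval_iff_modulus)
  have "dist (u y) (u x) < e" if "y \<in> {a..b}" "dist y x < \<delta>" for y
    using ac_modulusD[OF \<delta>(2), of "{()}" "\<lambda>_. min x y" "\<lambda>_. max x y"] that x
    by (cases "x \<le> y") (auto simp: dist_real_def disjoint_family_on_def)
  with \<delta>(1) show "\<exists>d>0. \<forall>x'\<in>{a..b}. dist x' x < d \<longrightarrow> dist (u x') (u x) < e"
    by blast
qed

context
  fixes u :: "real \<Rightarrow> real" and T :: real
  assumes T: "T > 0"
begin

definition dyadic_point :: "nat \<Rightarrow> nat \<Rightarrow> real" where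
  "dyadic_point n k = T * real k / 2 ^ n"

definition dyadic_variation :: "nat \<Rightarrow> real \<Rightarrow> real" where
  "dyadic_variation n x =
    (\<Sum>k<2 ^ n. \<bar>u (min x (dyadic_point n (Suc k))) - u (min x (dyadic_point n k))\<bar>)"

lemma dyadic_point_le: "j \<le> k \<Longrightarrow> dyadic_point n j \<le> dyadic_point n k"
  using T by (auto simp: dyadic_point_def divide_right_mono)

lemma dyadic_point_nonneg: "0 \<le> dyadic_point n k"
  using T by (simp add: dyadic_point_def)

lemma dyadic_point_le_T: "k \<le> 2 ^ n \<Longrightarrow> dyadic_point n k \<le> T"
proof -
  assume "k \<le> 2 ^ n"
  then have "real k \<le> 2 ^ n" by (metis of_nat_le_iff of_nat_numeral of_nat_power)
  then show ?thesis using T by (simp add: dyadic_point_def field_simps)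
qed

lemma dyadic_point_refine: "dyadic_point (n + m) (k * 2 ^ m) = dyadic_point n k"
  by (simp add: dyadic_point_def power_add)

lemma sum_dyadic_refine:
  fixes g :: "nat \<Rightarrow> real"
  shows "(\<Sum>k<2 ^ Suc n. g k) = (\<Sum>k<2 ^ n. g (2 * k) + g (Suc (2 * k)))"
proof -
  have "(\<Sum>k<2 * N. g k) = (\<Sum>k<N. g (2 * k) + g (Suc (2 * k)))" for N
    by (induction N) auto
  from this[of "2 ^ n"] show ?thesis by simp
qed

lemma dyadic_variation_mono: "dyadic_variation n x \<le> dyadic_variation (Suc n) x"
proof -
  have *: "dyadic_point (Suc n) (2 * k) = dyadic_point n k" for k
    by (simp add: dyadic_point_def)
  then have **: "dyadic_point (Suc n) (Suc (Suc (2 * k))) = dyadic_point n (Suc k)" for k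
    using *[of "Suc k"] by simp
  show ?thesis
    unfolding dyadic_variation_def[of "Suc n"] sum_dyadic_refine * ** dyadic_variation_def[of n]
    by (intro sum_mono) linarith
qed

text \<open>The pieces of the intervals \<open>{x i<..<y i}\<close> cut at the dyadic points again form a disjoint family
  of the same total length.\<close>

lemma dyadic_variation_modulus:
  assumes ac: "ac_modulus 0 T u \<epsilon> \<delta>" and fin: "finite I"
    and xy: "\<And>i. i \<in> I \<Longrightarrow> 0 \<le> x i \<and> x i \<le> y i \<and> y i \<le> T"
    and disj: "disjoint_family_on (\<lambda>i. {x i<..<y i}) I"
    and len: "(\<Sum>i\<in>I. y i - x i) < \<delta>"
  shows "(\<Sum>i\<in>I. \<bar>dyadic_variation n (y i) - dyadic_variation n (x i)\<bar>) < \<epsilon>"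
proof -
  define clamp where "clamp k z = max (dyadic_point n k) (min z (dyadic_point n (Suc k)))" for k z
  have pp: "dyadic_point n k \<le> dyadic_point n (Suc k)" for k
    by (rule dyadic_point_le) simp
  have piece: "\<bar>\<bar>u (min b (dyadic_point n (Suc k))) - u (min b (dyadic_point n k))\<bar> -
      \<bar>u (min a (dyadic_point n (Suc k))) - u (min a (dyadic_point n k))\<bar>\<bar> \<le>
      \<bar>u (clamp k b) - u (clamp k a)\<bar>" if "a \<le> b" for a b k
    using that pp[of k] unfolding clamp_def min_def max_def by (auto split: if_splits)
  have tele: "(\<Sum>k<m. clamp k z) = (\<Sum>k<m. dyadic_point n k) + min z (dyadic_point n m)"
    if "0 \<le> z" for z m
  proof (induction m)
    case 0
    then show ?case using that by (simp add: dyadic_point_def)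
  next
    case (Suc m)
    then show ?case using pp[of m] by (auto simp: clamp_def min_def max_def)
  qed
  have T': "dyadic_point n (2 ^ n) = T"
    by (simp add: dyadic_point_def)
  have le: "\<bar>dyadic_variation n (y i) - dyadic_variation n (x i)\<bar> \<le>
      (\<Sum>k<2 ^ n. \<bar>u (clamp k (y i)) - u (clamp k (x i))\<bar>)" if "i \<in> I" for i
  proof -
    have "\<bar>dyadic_variation n (y i) - dyadic_variation n (x i)\<bar> \<le>
        (\<Sum>k<2 ^ n. \<bar>\<bar>u (min (y i) (dyadic_point n (Suc k))) - u (min (y i) (dyadic_point n k))\<bar> -
          \<bar>u (min (x i) (dyadic_point n (Suc k))) - u (min (x i) (dyadic_point n k))\<bar>\<bar>)"
      unfolding dyadic_variation_def sum_subtractf[symmetric] by (rule sum_abs)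
    also have "\<dots> \<le> (\<Sum>k<2 ^ n. \<bar>u (clamp k (y i)) - u (clamp k (x i))\<bar>)"
      using xy[OF that] by (intro sum_mono piece) auto
    finally show ?thesis .
  qed
  have "(\<Sum>i\<in>I. \<bar>dyadic_variation n (y i) - dyadic_variation n (x i)\<bar>) \<le>
      (\<Sum>i\<in>I. \<Sum>k<2 ^ n. \<bar>u (clamp k (y i)) - u (clamp k (x i))\<bar>)"
    by (intro sum_mono le)
  also have "\<dots> = (\<Sum>p\<in>I \<times> {..<2 ^ n :: nat}. \<bar>u (clamp (snd p) (y (fst p))) - u (clamp (snd p) (x (fst p)))\<bar>)"
    by (simp add: sum.cartesian_product split_beta)
  also have "\<dots> < \<epsilon>"
  proof (rule ac_modulusD[OF ac])
    show "finite (I \<times> {..<2 ^ n :: nat})" using fin by simp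
    show "0 \<le> clamp (snd p) (x (fst p)) \<and> clamp (snd p) (x (fst p)) \<le> clamp (snd p) (y (fst p)) \<and>
        clamp (snd p) (y (fst p)) \<le> T" if "p \<in> I \<times> {..<2 ^ n :: nat}" for p
      using that xy[of "fst p"] dyadic_point_nonneg[of n "snd p"] dyadic_point_le_T[of "Suc (snd p)" n]
        pp[of "snd p"]
      by (auto simp: clamp_def min_def max_def Suc_le_eq)
    show "disjoint_family_on (\<lambda>p. {clamp (snd p) (x (fst p))<..<clamp (snd p) (y (fst p))}) (I \<times> {..<2 ^ n :: nat})"
      unfolding disjoint_family_on_def
    proof (intro ballI impI)
      fix p q assume pq: "p \<in> I \<times> {..<2 ^ n :: nat}" "q \<in> I \<times> {..<2 ^ n :: nat}" "p \<noteq> q"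
      have sub1: "{clamp k (x i)<..<clamp k (y i)} \<subseteq> {x i<..<y i}" for i k
        using pp[of k] by (auto simp: clamp_def min_def max_def split: if_splits)
      have sub2: "{clamp k (x i)<..<clamp k (y i)} \<subseteq> {dyadic_point n k<..<dyadic_point n (Suc k)}" for i k
        using pp[of k] by (auto simp: clamp_def min_def max_def split: if_splits)
      show "{clamp (snd p) (x (fst p))<..<clamp (snd p) (y (fst p))} \<inter>
          {clamp (snd q) (x (fst q))<..<clamp (snd q) (y (fst q))} = {}"
      proof (cases "fst p = fst q")
        case True
        then have "snd p < snd q \<or> snd q < snd p"
          using pq by (metis linorder_neqE_nat prod_eqI)
        then have "dyadic_point n (Suc (snd p)) \<le> dyadic_point n (snd q) \<or>
            dyadic_point n (Suc (snd q)) \<le> dyadic_point n (snd p)"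
          by (auto intro!: dyadic_point_le)
        then have "{dyadic_point n (snd p)<..<dyadic_point n (Suc (snd p))} \<inter>
            {dyadic_point n (snd q)<..<dyadic_point n (Suc (snd q))} = {}"
          by auto
        then show ?thesis using sub2 by blast
      next
        case False
        then have "{x (fst p)<..<y (fst p)} \<inter> {x (fst q)<..<y (fst q)} = {}"
          using pq by (intro disjoint_family_onD[OF disj]) auto
        then show ?thesis using sub1 by blast
      qed
    qed
    have "(\<Sum>p\<in>I \<times> {..<2 ^ n :: nat}. clamp (snd p) (y (fst p)) - clamp (snd p) (x (fst p))) =
        (\<Sum>i\<in>I. (\<Sum>k<2 ^ n. clamp k (y i)) - (\<Sum>k<2 ^ n. clamp k (x i)))"
      by (simp add: sum.cartesian_product split_beta flip: sum_subtractf)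
    also have "\<dots> = (\<Sum>i\<in>I. y i - x i)"
    proof (rule sum.cong[OF refl])
      fix i assume "i \<in> I"
      with xy[OF this] show "(\<Sum>k<2 ^ n. clamp k (y i)) - (\<Sum>k<2 ^ n. clamp k (x i)) = y i - x i"
        using tele[of "y i" "2 ^ n"] tele[of "x i" "2 ^ n"] T' by auto
    qed
    finally show "(\<Sum>p\<in>I \<times> {..<2 ^ n :: nat}. clamp (snd p) (y (fst p)) - clamp (snd p) (x (fst p))) < \<delta>"
      using len by simp
  qed
  finally show ?thesis .
qed

lemma dyadic_variation_bounded:
  assumes ac: "ac_modulus 0 T u 1 \<delta>" and "T / 2 ^ m < \<delta>" and x: "x \<in> {0..T}"
  shows "dyadic_variation n x \<le> 2 ^ m"
proof -
  have "dyadic_variation n (real j * (x / 2 ^ m)) \<le> real j" if "j \<le> 2 ^ m" for j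
    using that
  proof (induction j)
    case 0
    have "min 0 (dyadic_point n k) = 0" for k
      using dyadic_point_nonneg[of n k] by simp
    then show ?case by (simp add: dyadic_variation_def)
  next
    case (Suc j)
    have "real (Suc j) \<le> 2 ^ m" using Suc.prems by (metis of_nat_le_iff of_nat_numeral of_nat_power)
    then have "real (Suc j) * x \<le> 2 ^ m * T"
      using x by (intro mult_mono) auto
    then have le: "real (Suc j) * (x / 2 ^ m) \<le> T"
      by (simp add: field_simps)
    have "x / 2 ^ m \<le> T / 2 ^ m"
      using x by (intro divide_right_mono) auto
    moreover have "real (Suc j) * (x / 2 ^ m) = real j * (x / 2 ^ m) + x / 2 ^ m"
      by (simp add: algebra_simps add_divide_distrib)
    moreover have "0 \<le> real j * (x / 2 ^ m)" "0 \<le> x / 2 ^ m"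
      using x by auto
    ultimately have "\<bar>dyadic_variation n (real (Suc j) * (x / 2 ^ m)) - dyadic_variation n (real j * (x / 2 ^ m))\<bar> < 1"
      using dyadic_variation_modulus[OF ac, of "{()}" "\<lambda>_. real j * (x / 2 ^ m)" "\<lambda>_. real (Suc j) * (x / 2 ^ m)" n]
        le assms(2) by (simp add: disjoint_family_on_def)
    with Suc show ?case by auto
  qed
  from this[of "2 ^ m"] show ?thesis by simp
qed

definition variation_limit :: "real \<Rightarrow> real" where
  "variation_limit x = lim (\<lambda>n. dyadic_variation n x)"

lemma dyadic_variation_tendsto:
  assumes ac: "abs_continuous_on_interval 0 T u" and x: "x \<in> {0..T}"
  shows "(\<lambda>n. dyadic_variation n x) \<longlonglongrightarrow> variation_limit x"
proof -
  obtain \<delta> where \<delta>: "\<delta> > 0" "ac_modulus 0 T u 1 \<delta>"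
    using ac zero_less_one unfolding abs_continuous_on_interval_iff_modulus by blast
  obtain m where "T / \<delta> < 2 ^ m"
    using real_arch_pow[of 2 "T / \<delta>"] by auto
  then have "T / 2 ^ m < \<delta>"
    using \<delta>(1) by (simp add: field_simps)
  from dyadic_variation_bounded[OF \<delta>(2) this x]
  have "dyadic_variation n x \<le> 2 ^ m" for n .
  moreover have "incseq (\<lambda>n. dyadic_variation n x)"
    by (intro incseq_SucI dyadic_variation_mono)
  ultimately have "convergent (\<lambda>n. dyadic_variation n x)"
    using incseq_convergent[of "\<lambda>n. dyadic_variation n x" "2 ^ m"] convergentI by blast
  then show ?thesis
    by (simp add: variation_limit_def convergent_LIMSEQ_iff)
qed

lemma abs_continuous_variation_limit:
  assumes ac: "abs_continuous_on_interval 0 T u"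
  shows "abs_continuous_on_interval 0 T variation_limit"
  unfolding abs_continuous_on_interval_iff_modulus
proof (intro allI impI)
  fix \<epsilon> :: real assume "\<epsilon> > 0"
  then obtain \<delta> where \<delta>: "\<delta> > 0" "ac_modulus 0 T u (\<epsilon> / 2) \<delta>"
    using ac by (auto simp: abs_continuous_on_interval_iff_modulus dest: spec[of _ "\<epsilon> / 2"])
  have "ac_modulus 0 T variation_limit \<epsilon> \<delta>"
    unfolding ac_modulus_def
  proof (intro allI impI, elim conjE)
    fix n :: nat and x y
    assume xy: "\<forall>i<n. 0 \<le> x i \<and> x i \<le> y i \<and> y i \<le> T"
      and disj: "disjoint_family_on (\<lambda>i. {x i<..<y i}) {..<n}" and len: "(\<Sum>i<n. y i - x i) < \<delta>"
    have "(\<Sum>i<n. \<bar>variation_limit (y i) - variation_limit (x i)\<bar>) \<le> \<epsilon> / 2"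
    proof (rule LIMSEQ_le_const2)
      show "(\<lambda>m. \<Sum>i<n. \<bar>dyadic_variation m (y i) - dyadic_variation m (x i)\<bar>) \<longlonglongrightarrow>
          (\<Sum>i<n. \<bar>variation_limit (y i) - variation_limit (x i)\<bar>)"
        using xy by (intro tendsto_intros dyadic_variation_tendsto[OF ac]) force+
      show "\<exists>N. \<forall>m\<ge>N. (\<Sum>i<n. \<bar>dyadic_variation m (y i) - dyadic_variation m (x i)\<bar>) \<le> \<epsilon> / 2"
        using dyadic_variation_modulus[OF \<delta>(2), of "{..<n}" x y] xy disj len by (auto intro: less_imp_le)
    qed
    then show "(\<Sum>i<n. \<bar>variation_limit (y i) - variation_limit (x i)\<bar>) < \<epsilon>"
      using \<open>\<epsilon> > 0\<close> by simp
  qed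
  with \<delta>(1) show "\<exists>\<delta>>0. ac_modulus 0 T variation_limit \<epsilon> \<delta>" by blast
qed

lemma dyadic_variation_dyadic_points:
  assumes "j \<le> k" "k \<le> 2 ^ n"
  shows "\<bar>u (dyadic_point n k) - u (dyadic_point n j)\<bar> \<le>
    dyadic_variation n (dyadic_point n k) - dyadic_variation n (dyadic_point n j)"
proof -
  let ?d = "\<lambda>i. u (dyadic_point n (Suc i)) - u (dyadic_point n i)"
  have *: "dyadic_variation n (dyadic_point n l) = (\<Sum>i<l. \<bar>?d i\<bar>)" if "l \<le> 2 ^ n" for l
  proof -
    have "dyadic_variation n (dyadic_point n l) = (\<Sum>i<2 ^ n. if i < l then \<bar>?d i\<bar> else 0)"
      unfolding dyadic_variation_def
    proof (intro sum.cong refl)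
      fix i
      show "\<bar>u (min (dyadic_point n l) (dyadic_point n (Suc i))) - u (min (dyadic_point n l) (dyadic_point n i))\<bar> =
          (if i < l then \<bar>?d i\<bar> else 0)"
        using dyadic_point_le[of "Suc i" l n] dyadic_point_le[of i l n]
          dyadic_point_le[of l i n] dyadic_point_le[of l "Suc i" n]
        by (auto simp: min_absorb1 min_absorb2)
    qed
    also have "\<dots> = (\<Sum>i<l. \<bar>?d i\<bar>)"
      using that by (intro sum.mono_neutral_cong_right) auto
    finally show ?thesis .
  qed
  have "u (dyadic_point n k) - u (dyadic_point n j) = (\<Sum>i=j..<k. ?d i)"
    using sum_Suc_diff'[OF assms(1), of "\<lambda>i. u (dyadic_point n i)"] by simp
  also have "\<bar>\<dots>\<bar> \<le> (\<Sum>i=j..<k. \<bar>?d i\<bar>)"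
    by (rule sum_abs)
  also have "\<dots> = (\<Sum>i<k. \<bar>?d i\<bar>) - (\<Sum>i<j. \<bar>?d i\<bar>)"
    using sum_diff_nat_ivl[of 0 j k "\<lambda>i. \<bar>?d i\<bar>"] assms(1) by (simp add: atLeast0LessThan)
  finally show ?thesis
    using assms by (simp add: *)
qed

lemma variation_limit_ge:
  assumes ac: "abs_continuous_on_interval 0 T u" and xy: "0 \<le> x" "x \<le> y" "y \<le> T"
  shows "\<bar>u y - u x\<bar> \<le> variation_limit y - variation_limit x"
proof -
  have dyadic: "\<bar>u (dyadic_point m k) - u (dyadic_point m j)\<bar> \<le>
      variation_limit (dyadic_point m k) - variation_limit (dyadic_point m j)"
    if "j \<le> k" "k \<le> 2 ^ m" for j k m
  proof (rule LIMSEQ_le_const)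
    have "dyadic_point m j \<in> {0..T}" "dyadic_point m k \<in> {0..T}"
      using that dyadic_point_nonneg dyadic_point_le_T by auto
    then show "(\<lambda>n. dyadic_variation n (dyadic_point m k) - dyadic_variation n (dyadic_point m j)) \<longlonglongrightarrow>
        variation_limit (dyadic_point m k) - variation_limit (dyadic_point m j)"
      by (intro tendsto_diff dyadic_variation_tendsto[OF ac])
    have "\<bar>u (dyadic_point m k) - u (dyadic_point m j)\<bar> \<le>
        dyadic_variation n (dyadic_point m k) - dyadic_variation n (dyadic_point m j)" if "n \<ge> m" for n
    proof -
      obtain r where r: "n = m + r" using \<open>n \<ge> m\<close> le_Suc_ex by blast
      show ?thesis
        using dyadic_variation_dyadic_points[of "j * 2 ^ r" "k * 2 ^ r" "m + r"] \<open>j \<le> k\<close> \<open>k \<le> 2 ^ m\<close>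
        by (simp add: r dyadic_point_refine power_add)
    qed
    then show "\<exists>N. \<forall>n\<ge>N. \<bar>u (dyadic_point m k) - u (dyadic_point m j)\<bar> \<le>
        dyadic_variation n (dyadic_point m k) - dyadic_variation n (dyadic_point m j)"
      by blast
  qed
  define idx where "idx n z = nat \<lfloor>z * 2 ^ n / T\<rfloor>" for n z
  have idx_lim: "(\<lambda>n. dyadic_point n (idx n z)) \<longlonglongrightarrow> z" if "0 \<le> z" for z
  proof (rule tendsto_sandwich)
    have *: "real (idx n z) \<le> z * 2 ^ n / T" "z * 2 ^ n / T \<le> real (idx n z) + 1" for n
      using T that by (auto simp: idx_def)
    show "\<forall>\<^sub>F n in sequentially. dyadic_point n (idx n z) \<le> z"
      using *(1) T by (intro always_eventually) (auto simp: dyadic_point_def field_simps)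
    show "\<forall>\<^sub>F n in sequentially. z - T / 2 ^ n \<le> dyadic_point n (idx n z)"
    proof (intro always_eventually allI)
      fix n
      have "z - T / 2 ^ n = T * (z * 2 ^ n / T - 1) / 2 ^ n"
        using T by (simp add: diff_divide_distrib right_diff_distrib)
      also have "\<dots> \<le> T * real (idx n z) / 2 ^ n"
        using *(2)[of n] T by (intro divide_right_mono mult_left_mono) auto
      finally show "z - T / 2 ^ n \<le> dyadic_point n (idx n z)"
        by (simp add: dyadic_point_def)
    qed
    have "(\<lambda>n. z - T * (1 / 2) ^ n) \<longlonglongrightarrow> z - T * 0"
      by (intro tendsto_intros LIMSEQ_power_zero) auto
    then show "(\<lambda>n. z - T / 2 ^ n) \<longlonglongrightarrow> z" by (simp add: power_one_over)
  qed simp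
  have idx_le: "idx n z \<le> 2 ^ n" if "z \<le> T" for n z
  proof -
    have "z * 2 ^ n / T \<le> 2 ^ n" using that T by (simp add: field_simps)
    then have "\<lfloor>z * 2 ^ n / T\<rfloor> \<le> 2 ^ n" by (simp add: floor_le_iff)
    then show ?thesis unfolding idx_def by (simp add: nat_le_iff)
  qed
  have idx_mono: "idx n x \<le> idx n y" for n
    unfolding idx_def using xy T by (intro nat_mono floor_mono divide_right_mono mult_right_mono) auto
  have lim: "(\<lambda>n. h (dyadic_point n (idx n z))) \<longlonglongrightarrow> h z"
    if "continuous_on {0..T} h" "0 \<le> z" "z \<le> T" for h z
    using that dyadic_point_nonneg dyadic_point_le_T idx_le
    by (intro continuous_on_tendsto_compose[OF that(1) idx_lim]) (auto intro!: always_eventually)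
  have "continuous_on {0..T} u" "continuous_on {0..T} variation_limit"
    using ac abs_continuous_variation_limit[OF ac] by (simp_all add: abs_continuous_imp_continuous_on)
  note lims = this[THEN lim]
  show ?thesis
  proof (rule LIMSEQ_le)
    show "(\<lambda>n. \<bar>u (dyadic_point n (idx n y)) - u (dyadic_point n (idx n x))\<bar>) \<longlonglongrightarrow> \<bar>u y - u x\<bar>"
      using xy by (intro tendsto_intros lims) auto
    show "(\<lambda>n. variation_limit (dyadic_point n (idx n y)) - variation_limit (dyadic_point n (idx n x)))
        \<longlonglongrightarrow> variation_limit y - variation_limit x"
      using xy by (intro tendsto_intros lims) auto
    show "\<exists>N. \<forall>n\<ge>N. \<bar>u (dyadic_point n (idx n y)) - u (dyadic_point n (idx n x))\<bar> \<le>
        variation_limit (dyadic_point n (idx n y)) - variation_limit (dyadic_point n (idx n x))"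
      using dyadic idx_mono idx_le xy by auto
  qed
qed

end

lemma abs_continuous_on_interval_add:
  fixes u v :: "real \<Rightarrow> real"
  assumes "abs_continuous_on_interval a b u" "abs_continuous_on_interval a b v"
  shows "abs_continuous_on_interval a b (\<lambda>x. u x + v x)"
  unfolding abs_continuous_on_interval_iff_modulus
proof (intro allI impI)
  fix \<epsilon> :: real assume "\<epsilon> > 0"
  then have "\<epsilon> / 2 > 0" by simp
  then obtain \<delta>1 \<delta>2 where \<delta>: "\<delta>1 > 0" "ac_modulus a b u (\<epsilon> / 2) \<delta>1" "\<delta>2 > 0" "ac_modulus a b v (\<epsilon> / 2) \<delta>2"
    using assms unfolding abs_continuous_on_interval_iff_modulus by meson
  have "ac_modulus a b (\<lambda>x. u x + v x) \<epsilon> (min \<delta>1 \<delta>2)"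
    unfolding ac_modulus_def
  proof (intro allI impI, elim conjE)
    fix n :: nat and x y
    assume xy: "\<forall>i<n. a \<le> x i \<and> x i \<le> y i \<and> y i \<le> b"
      and disj: "disjoint_family_on (\<lambda>i. {x i<..<y i}) {..<n}" and len: "(\<Sum>i<n. y i - x i) < min \<delta>1 \<delta>2"
    have "(\<Sum>i<n. \<bar>u (y i) + v (y i) - (u (x i) + v (x i))\<bar>) \<le>
        (\<Sum>i<n. \<bar>u (y i) - u (x i)\<bar>) + (\<Sum>i<n. \<bar>v (y i) - v (x i)\<bar>)"
      unfolding sum.distrib[symmetric] by (intro sum_mono) linarith
    also have "\<dots> < \<epsilon> / 2 + \<epsilon> / 2"
      using xy len by (intro add_strict_mono ac_modulusD[OF \<delta>(2) _ _ disj] ac_modulusD[OF \<delta>(4) _ _ disj]) auto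
    finally show "(\<Sum>i<n. \<bar>u (y i) + v (y i) - (u (x i) + v (x i))\<bar>) < \<epsilon>" by simp
  qed
  with \<delta> show "\<exists>\<delta>>0. ac_modulus a b (\<lambda>x. u x + v x) \<epsilon> \<delta>" by (metis min_less_iff_conj)
qed

lemma emeasure_interval_measure_elementary_le:
  fixes F H :: "real \<Rightarrow> real"
  assumes ac: "ac_modulus 0 T F \<epsilon> \<delta>" and T: "0 \<le> T" and \<epsilon>: "0 \<le> \<epsilon>"
    and H: "H = (\<lambda>x. F (max 0 (min T x)))" and mono: "\<And>x y. x \<le> y \<Longrightarrow> H x \<le> H y"
    and cont: "continuous_on UNIV H"
    and p: "p division_of E" and U: "E \<subseteq> U" "U \<in> sets lborel" "emeasure lborel U < ennreal \<delta>"
  shows "emeasure (interval_measure H) E \<le> ennreal \<epsilon>"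
proof -
  note pD = division_ofD[OF p]
  define c where "c z = max 0 (min T z)" for z
  have K: "K = {Inf K..Sup K} \<and> Inf K \<le> Sup K" if K: "K \<in> p" for K
  proof -
    obtain a b where "K = {a..b}" using pD(4)[OF K] by auto
    moreover have "K \<noteq> {}" using pD(3)[OF K] .
    ultimately show ?thesis by auto
  qed
  have K_le: "Inf K \<le> Sup K" if "K \<in> p" for K
    using K[OF that] by blast
  have c_le: "c b - c a \<le> b - a" if "a \<le> b" for a b
    using that T by (auto simp: c_def)
  have sets_K: "K \<in> sets borel" if "K \<in> p" for K
    using pD(4)[OF that] by auto
  have "emeasure (interval_measure H) E = emeasure (interval_measure H) (\<Union>K\<in>p. K)"
    using pD(6) by simp
  also have "\<dots> \<le> (\<Sum>K\<in>p. emeasure (interval_measure H) K)"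
    using pD(1) sets_K by (intro emeasure_subadditive_finite) auto
  also have "\<dots> = (\<Sum>K\<in>p. ennreal \<bar>F (c (Sup K)) - F (c (Inf K))\<bar>)"
  proof (intro sum.cong refl)
    fix K assume "K \<in> p"
    from K[OF this] have "emeasure (interval_measure H) K = ennreal (H (Sup K) - H (Inf K))"
      by (metis emeasure_interval_measure_Icc mono cont)
    then show "emeasure (interval_measure H) K = ennreal \<bar>F (c (Sup K)) - F (c (Inf K))\<bar>"
      using mono[of "Inf K" "Sup K"] K_le[OF \<open>K \<in> p\<close>] by (simp add: H c_def)
  qed
  also have "\<dots> = ennreal (\<Sum>K\<in>p. \<bar>F (c (Sup K)) - F (c (Inf K))\<bar>)"
    by (intro sum_ennreal) auto
  also have "\<dots> \<le> ennreal \<epsilon>"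
  proof (intro ennreal_leI less_imp_le ac_modulusD[OF ac pD(1)])
    show "0 \<le> c (Inf K) \<and> c (Inf K) \<le> c (Sup K) \<and> c (Sup K) \<le> T" if "K \<in> p" for K
      using K_le[OF that] T by (auto simp: c_def)
    have int: "{Inf K<..<Sup K} = interior K" if "K \<in> p" for K
      using K[OF that] by (metis interior_atLeastAtMost_real)
    show "disjoint_family_on (\<lambda>K. {c (Inf K)<..<c (Sup K)}) p"
      unfolding disjoint_family_on_def
    proof (intro ballI impI)
      fix K L assume KL: "K \<in> p" "L \<in> p" "K \<noteq> L"
      have sub: "{c a<..<c b} \<subseteq> {a<..<b}" for a b
        by (auto simp: c_def)
      show "{c (Inf K)<..<c (Sup K)} \<inter> {c (Inf L)<..<c (Sup L)} = {}"
        using sub[of "Inf K" "Sup K"] sub[of "Inf L" "Sup L"] pD(5)[OF KL] int KL by blast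
    qed
    have disj: "disjoint_family_on (\<lambda>K. {Inf K<..<Sup K}) p"
      using pD(5) int by (auto simp: disjoint_family_on_def)
    have "ennreal (\<Sum>K\<in>p. c (Sup K) - c (Inf K)) \<le> ennreal (\<Sum>K\<in>p. Sup K - Inf K)"
      using K_le by (intro ennreal_leI sum_mono c_le) auto
    also have "\<dots> = (\<Sum>K\<in>p. emeasure lborel {Inf K<..<Sup K})"
      using K_le by (subst sum_ennreal[symmetric]) auto
    also have "\<dots> = emeasure lborel (\<Union>K\<in>p. {Inf K<..<Sup K})"
      using pD(1) disj by (intro sum_emeasure) auto
    also have "\<dots> \<le> emeasure lborel U"
      using U pD(2) int interior_subset by (intro emeasure_mono) blast+
    finally have "ennreal (\<Sum>K\<in>p. c (Sup K) - c (Inf K)) < ennreal \<delta>"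
      using U(3) by simp
    then show "(\<Sum>K\<in>p. c (Sup K) - c (Inf K)) < \<delta>"
      by (metis ennreal_leI not_le)
  qed
  finally show ?thesis .
qed

lemma absolutely_continuous_interval_measure:
  fixes F H :: "real \<Rightarrow> real"
  assumes ac: "abs_continuous_on_interval 0 T F" and T: "0 \<le> T"
    and H: "H = (\<lambda>x. F (max 0 (min T x)))" and mono: "\<And>x y. x \<le> y \<Longrightarrow> H x \<le> H y"
    and cont: "continuous_on UNIV H"
  shows "absolutely_continuous lborel (interval_measure H)"
  unfolding absolutely_continuous_def
proof
  fix A assume A: "A \<in> null_sets (lborel :: real measure)"
  have le: "emeasure (interval_measure H) A \<le> 0 + ennreal \<epsilon>" if \<epsilon>: "\<epsilon> > 0" for \<epsilon>
  proof -
    obtain \<delta> where \<delta>: "\<delta> > 0" "ac_modulus 0 T F \<epsilon> \<delta>"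
      using ac \<epsilon> unfolding abs_continuous_on_interval_iff_modulus by blast
    have A': "A \<in> null_sets lebesgue"
      using A by (rule null_sets_completionI)
    obtain U where U: "open U" "A \<subseteq> U" "emeasure lebesgue (U - A) < ennreal \<delta>"
      by (rule sets_lebesgue_outer_open[of A \<delta>]) (use A' \<delta>(1) that in \<open>auto simp: null_sets_def\<close>)
    have "emeasure lborel U < ennreal \<delta>"
      using U(3) emeasure_Diff_null_set[OF A', of U] U(1) by simp
    obtain D where D: "countable D" "D \<subseteq> Pow U" "\<And>X. X \<in> D \<Longrightarrow> \<exists>a b. X = cbox a b" "\<Union>D = U"
      by (rule open_countable_Union_open_cbox[OF U(1)]) (rule that)
    define E where "E n = (\<Union>i<n. from_nat_into (insert {} D) i)" for n
    have mem: "from_nat_into (insert {} D) i \<in> insert {} D" for i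
      by (rule from_nat_into) simp
    have box: "\<exists>a b. X = cbox a b" if "X \<in> insert {} D" for X
      using that D(3) empty_as_interval by blast
    have "range (from_nat_into (insert {} D)) = insert {} D"
      using D(1) by (intro range_from_nat_into) auto
    then have "(\<Union>i. from_nat_into (insert {} D) i) = U"
      using D(4) by auto
    then have EU: "(\<Union>n. E n) = U"
      unfolding E_def by auto
    have "emeasure (interval_measure H) (E n) \<le> ennreal \<epsilon>" for n
    proof -
      obtain p where "p division_of \<Union>(from_nat_into (insert {} D) ` {..<n})"
        by (rule elementary_unions_intervals[of "from_nat_into (insert {} D) ` {..<n}"])
          (use mem box that in \<open>auto simp del: cbox_interval\<close>)
      then have "p division_of E n"
        by (simp add: E_def)
      then show ?thesis
        using \<epsilon> EU U \<open>emeasure lborel U < ennreal \<delta>\<close>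
        by (intro emeasure_interval_measure_elementary_le[OF \<delta>(2) T _ H mono cont, of p _ U]) auto
    qed
    moreover have "(SUP n. emeasure (interval_measure H) (E n)) = emeasure (interval_measure H) U"
      unfolding EU[symmetric]
    proof (intro SUP_emeasure_incseq)
      show "range E \<subseteq> sets (interval_measure H)"
      proof
        fix X assume "X \<in> range E"
        then obtain n where X: "X = (\<Union>i<n. from_nat_into (insert {} D) i)"
          by (auto simp: E_def)
        have "from_nat_into (insert {} D) i \<in> sets borel" for i
          using box[OF mem[of i]] by auto
        then show "X \<in> sets (interval_measure H)"
          unfolding X sets_interval_measure by blast
      qed
      show "incseq E"
        unfolding E_def incseq_def by (intro allI impI UN_mono) auto
    qed
    ultimately have "emeasure (interval_measure H) U \<le> ennreal \<epsilon>"
      using SUP_least[of UNIV "\<lambda>n. emeasure (interval_measure H) (E n)"] by metis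
    then show ?thesis
      using emeasure_mono[OF U(2), of "interval_measure H"] U(1) by auto
  qed
  have "emeasure (interval_measure H) A \<le> 0"
    by (rule ennreal_le_epsilon) (rule le)
  then have "emeasure (interval_measure H) A = 0"
    by simp
  then show "A \<in> null_sets (interval_measure H)"
    using A by (auto simp: null_sets_def)
qed

lemma abs_continuous_mono_integral:
  fixes F :: "real \<Rightarrow> real"
  assumes ac: "abs_continuous_on_interval 0 T F" and T: "0 < T" and mono: "mono_on {0..T} F"
  obtains g where "integrable lborel g" "\<And>x. x \<notin> {0<..T} \<Longrightarrow> g x = 0"
    "\<And>x. x \<in> {0..T} \<Longrightarrow> (LINT s:{..x}|lborel. g s) = F x - F 0"
proof -
  define H where "H = (\<lambda>x. F (max 0 (min T x)))"
  have H_mono: "H x \<le> H y" if "x \<le> y" for x y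
    unfolding H_def using that T by (intro mono_onD[OF mono]) auto
  have H_cont: "continuous_on UNIV H"
    unfolding H_def
    by (rule continuous_on_compose2[OF abs_continuous_imp_continuous_on[OF ac]])
      (use T in \<open>auto intro!: continuous_intros\<close>)
  have "\<exists>h\<in>borel_measurable lborel. density lborel h = interval_measure H"
    using absolutely_continuous_interval_measure[OF ac _ H_def H_mono H_cont] T
    by (intro sigma_finite_measure.Radon_Nikodym sigma_finite_lborel) auto
  then obtain h where h[measurable]: "h \<in> borel_measurable borel" and dens: "density lborel h = interval_measure H"
    by auto
  have nn: "(\<integral>\<^sup>+s. h s * indicator {0<..x} s \<partial>lborel) = ennreal (F x - F 0)" if "x \<in> {0..T}" for x
  proof -
    have "(\<integral>\<^sup>+s. h s * indicator {0<..x} s \<partial>lborel) = emeasure (interval_measure H) {0<..x}"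
      by (simp add: emeasure_density flip: dens)
    also have "\<dots> = ennreal (H x - H 0)"
      using that H_cont
      by (intro emeasure_interval_measure_Ioc H_mono) (auto simp: continuous_on_eq_continuous_at continuous_at_imp_continuous_at_within)
    finally show ?thesis
      using that T by (simp add: H_def)
  qed
  have fin: "AE s in lborel. h s * indicator {0<..T} s \<noteq> \<infinity>"
    by (rule nn_integral_PInf_AE) (use nn[of T] T in auto)
  define g where "g s = enn2real (h s * indicator {0<..T} s)" for s
  have g[measurable]: "g \<in> borel_measurable borel"
    unfolding g_def by measurable
  have g0: "0 \<le> g s" for s
    by (simp add: g_def)
  have nng: "(\<integral>\<^sup>+s. ennreal (indicator {..x} s * g s) \<partial>lborel) = ennreal (F x - F 0)" if x: "x \<in> {0..T}" for x
  proof -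
    have "(\<integral>\<^sup>+s. ennreal (indicator {..x} s * g s) \<partial>lborel) = (\<integral>\<^sup>+s. h s * indicator {0<..x} s \<partial>lborel)"
    proof (rule nn_integral_cong_AE)
      show "AE s in lborel. ennreal (indicator {..x} s * g s) = h s * indicator {0<..x} s"
        using fin
      proof eventually_elim
        case (elim s)
        with x show ?case
          by (auto simp: g_def indicator_def less_top)
      qed
    qed
    with nn[OF x] show ?thesis by simp
  qed
  have nngT: "(\<integral>\<^sup>+s. ennreal (g s) \<partial>lborel) = ennreal (F T - F 0)"
  proof -
    have "indicator {..T} s * g s = g s" for s
      by (auto simp: g_def indicator_def)
    with nng[of T] T show ?thesis by simp
  qed
  have int: "integrable lborel g"
    by (rule integrableI_nn_integral_finite[OF _ _ nngT]) (use g0 in auto)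
  moreover have "g x = 0" if "x \<notin> {0<..T}" for x
    using that by (simp add: g_def)
  moreover have "(LINT s:{..x}|lborel. g s) = F x - F 0" if x: "x \<in> {0..T}" for x
    unfolding set_lebesgue_integral_def real_scaleR_def
    by (subst integral_eq_nn_integral)
      (use g0 nng[OF x] mono_onD[OF mono, of 0 x] x in auto)
  ultimately show thesis by (rule that)
qed

theorem abs_continuous_integral_real:
  fixes u :: "real \<Rightarrow> real"
  assumes ac: "abs_continuous_on_interval 0 T u" and T: "0 < T"
  obtains g where "integrable lborel g" "\<And>x. x \<notin> {0<..T} \<Longrightarrow> g x = 0"
    "\<And>x. x \<in> {0..T} \<Longrightarrow> (LINT s:{..x}|lborel. g s) = u x - u 0"
proof -
  let ?V = "variation_limit u T"
  have V: "abs_continuous_on_interval 0 T ?V"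
    by (rule abs_continuous_variation_limit[OF T ac])
  have ge: "\<bar>u y - u x\<bar> \<le> ?V y - ?V x" if "0 \<le> x" "x \<le> y" "y \<le> T" for x y
    by (rule variation_limit_ge[OF T ac that])
  have "mono_on {0..T} ?V" "mono_on {0..T} (\<lambda>x. u x + ?V x)"
    using ge by (fastforce intro!: mono_onI)+
  note mono = this
  obtain g where
    g: "integrable lborel g" "\<And>x. x \<notin> {0<..T} \<Longrightarrow> g x = 0"
      "\<And>x. x \<in> {0..T} \<Longrightarrow> (LINT s:{..x}|lborel. g s) = ?V x - ?V 0"
    by (rule abs_continuous_mono_integral[OF V T mono(1)]) (rule that)
  obtain h where
    h: "integrable lborel h" "\<And>x. x \<notin> {0<..T} \<Longrightarrow> h x = 0"
      "\<And>x. x \<in> {0..T} \<Longrightarrow> (LINT s:{..x}|lborel. h s) = u x + ?V x - (u 0 + ?V 0)"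
    by (rule abs_continuous_mono_integral[OF abs_continuous_on_interval_add[OF ac V] T mono(2)]) (rule that)
  show thesis
  proof (rule that)
    show "integrable lborel (\<lambda>x. h x - g x)"
      using g h by simp
    show "h x - g x = 0" if "x \<notin> {0<..T}" for x
      using g(2) h(2) that by simp
    fix x assume "x \<in> {0..T}"
    moreover have "set_integrable lborel {..x} g" "set_integrable lborel {..x} h"
      unfolding set_integrable_def using g(1) h(1) by (auto intro!: integrable_mult_indicator simp del: real_scaleR_def)
    ultimately show "(LINT s:{..x}|lborel. h s - g s) = u x - u 0"
      using g(3) h(3) by (simp add: set_integral_diff)
  qed
qed

lemma abs_continuous_derivative:
  fixes u :: "real \<Rightarrow> 'a::euclidean_space"
  assumes ac: "abs_continuous_on_interval 0 T u" and T: "0 < T" and u0: "u 0 = 0"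
  obtains g where "integrable lborel g" "\<And>x. x \<notin> {0<..<T} \<Longrightarrow> g x = 0"
    "\<And>x. x \<in> {0..T} \<Longrightarrow> (LINT s:{..x}|lborel. g s) = u x"
    "AE x in lborel. x \<in> {0<..<T} \<longrightarrow> g x = vector_derivative u (at x)"
proof -
  have "\<exists>g. integrable lborel g \<and> (\<forall>x. x \<notin> {0<..T} \<longrightarrow> g x = 0) \<and>
      (\<forall>x\<in>{0..T}. (LINT s:{..x}|lborel. g s) = u x \<bullet> b)" if b: "b \<in> Basis" for b
  proof -
    have le: "\<bar>u y \<bullet> b - u x \<bullet> b\<bar> \<le> norm (u y - u x)" for x y
      using Basis_le_norm[OF b, of "u y - u x"] by (simp add: inner_diff_left)
    have "abs_continuous_on_interval 0 T (\<lambda>t. u t \<bullet> b)"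
      unfolding abs_continuous_on_interval_def
    proof (intro allI impI)
      fix \<epsilon> :: real assume "\<epsilon> > 0"
      then obtain \<delta> where "\<delta> > 0" and \<delta>: "\<And>(n::nat) x y. (\<forall>i<n. 0 \<le> x i \<and> x i \<le> y i \<and> y i \<le> T) \<and>
          disjoint_family_on (\<lambda>i. {x i<..<y i}) {..<n} \<and> (\<Sum>i<n. y i - x i) < \<delta> \<Longrightarrow>
          (\<Sum>i<n. norm (u (y i) - u (x i))) < \<epsilon>"
        using ac unfolding abs_continuous_on_interval_def by blast
      have "(\<Sum>i<n. norm (u (y i) \<bullet> b - u (x i) \<bullet> b)) < \<epsilon>"
        if "(\<forall>i<n. 0 \<le> x i \<and> x i \<le> y i \<and> y i \<le> T) \<and>
          disjoint_family_on (\<lambda>i. {x i<..<y i}) {..<n} \<and> (\<Sum>i<n. y i - x i) < \<delta>"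
        for n :: nat and x y
        using \<delta>[OF that] le by (intro le_less_trans[OF sum_mono \<delta>[OF that]]) simp
      with \<open>\<delta> > 0\<close> show "\<exists>\<delta>>0. \<forall>(n::nat) x y.
          (\<forall>i<n. 0 \<le> x i \<and> x i \<le> y i \<and> y i \<le> T) \<and>
          disjoint_family_on (\<lambda>i. {x i<..<y i}) {..<n} \<and> (\<Sum>i<n. y i - x i) < \<delta> \<longrightarrow>
          (\<Sum>i<n. norm (u (y i) \<bullet> b - u (x i) \<bullet> b)) < \<epsilon>"
        by blast
    qed
    from abs_continuous_integral_real[OF this T] show ?thesis
      using u0 by (metis (no_types, lifting) inner_zero_left diff_zero)
  qed
  then obtain g where g: "\<And>b. b \<in> Basis \<Longrightarrow> integrable lborel (g b)"
      "\<And>b x. b \<in> Basis \<Longrightarrow> x \<in> {0..T} \<Longrightarrow> (LINT s:{..x}|lborel. g b s) = u x \<bullet> b"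
      "\<And>b x. b \<in> Basis \<Longrightarrow> x \<notin> {0<..T} \<Longrightarrow> g b x = 0"
    by metis
  define G where "G s = indicator {0<..<T} s *\<^sub>R (\<Sum>b\<in>Basis. g b s *\<^sub>R b)" for s
  have int: "integrable lborel G"
    unfolding G_def using g(1)
    by (intro integrable_mult_indicator Bochner_Integration.integrable_sum integrable_scaleR_left) auto
  have Gb: "(\<Sum>b\<in>Basis. (indicator {..x} s * g b s) *\<^sub>R b) = indicator {..x} s *\<^sub>R G s" if "s \<noteq> T" for s x
    using that g(3)[of _ s]
    by (cases "s \<in> {0<..<T}") (auto simp: G_def scaleR_sum_right)
  have Gu: "(LINT s:{..x}|lborel. G s) = u x" if x: "x \<in> {0..T}" for x
  proof -
    have "u x = (\<Sum>b\<in>Basis. (LINT s|lborel. indicator {..x} s * g b s) *\<^sub>R b)"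
      using g(2)[OF _ x] euclidean_representation[of "u x"] by (simp add: set_lebesgue_integral_def)
    also have "\<dots> = (LINT s|lborel. (\<Sum>b\<in>Basis. (indicator {..x} s * g b s) *\<^sub>R b))"
      using g(1) by (subst Bochner_Integration.integral_sum)
        (auto simp: integral_scaleR_left_zero intro!: integrable_scaleR_left
          integrable_mult_indicator[where 'b=real, simplified])
    also have "\<dots> = (LINT s|lborel. indicator {..x} s *\<^sub>R G s)"
    proof (rule integral_cong_AE)
      show "AE s in lborel. (\<Sum>b\<in>Basis. (indicator {..x} s * g b s) *\<^sub>R b) = indicator {..x} s *\<^sub>R G s"
        using AE_lborel_singleton[of T] by eventually_elim (rule Gb)
    qed (use g(1) int in \<open>auto intro!: borel_measurable_sum borel_measurable_scaleR borel_measurable_times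
      dest: borel_measurable_integrable\<close>)
    finally show ?thesis by (simp add: set_lebesgue_integral_def)
  qed
  have deriv: "AE x in lborel. x \<in> {0<..<T} \<longrightarrow> G x = vector_derivative u (at x)"
    using AE_has_vector_derivative_integral[OF int]
  proof eventually_elim
    case (elim x)
    show ?case
    proof
      assume x: "x \<in> {0<..<T}"
      have "(u has_vector_derivative G x) (at x)"
        by (rule has_vector_derivative_transform_within_open[OF elim _ x]) (use Gu in auto)
      then show "G x = vector_derivative u (at x)"
        by (simp add: vector_derivative_at)
    qed
  qed
  show thesis
    by (rule that[OF int _ Gu deriv]) (auto simp: G_def)
qed

section \<open>Laplace transforms\<close>

lemma has_bochner_integral_powr_exp:
  fixes a x :: real
  assumes a: "0 < a" and x: "0 < x"
  shows "has_bochner_integral lborel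
    (\<lambda>t. indicator {0<..} t * (t powr (a - 1) * exp (- (x * t)))) (Gamma a / x powr a)"
proof -
  let ?G = "\<lambda>t::real. indicator {0..} t * t powr (a - 1) / exp t"
  have "has_bochner_integral lborel ?G (Gamma a)"
  proof (rule has_bochner_integral_nn_integral)
    show "(\<integral>\<^sup>+t. ennreal (?G t) \<partial>lborel) = ennreal (Gamma a)"
      using Gamma_conv_nn_integral_real[OF a] by simp
  qed (use a in \<open>auto simp: less_imp_le Gamma_real_pos\<close>)
  then have "has_bochner_integral lborel (\<lambda>t. ?G (0 + x * t)) (Gamma a /\<^sub>R \<bar>x\<bar>)"
    using x by (subst (asm) lborel_has_bochner_integral_real_affine_iff[of x _ _ 0]) auto
  then have "has_bochner_integral lborel (\<lambda>t. x powr (1 - a) * ?G (0 + x * t))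
      (x powr (1 - a) * (Gamma a /\<^sub>R \<bar>x\<bar>))"
    by (rule has_bochner_integral_mult_right)
  moreover have "x powr (1 - a) * ?G (0 + x * t) =
      indicator {0<..} t * (t powr (a - 1) * exp (- (x * t)))" for t
  proof (cases "t > 0")
    case True
    have "x powr (1 - a) * x powr (a - 1) = 1"
      using x by (simp add: powr_add[symmetric])
    then show ?thesis
      using True x by (simp add: powr_mult exp_minus field_simps)
  qed (use x in \<open>auto simp: indicator_def zero_le_mult_iff\<close>)
  moreover have "x powr (1 - a) * (Gamma a /\<^sub>R \<bar>x\<bar>) = Gamma a / x powr a"
    using x by (simp add: powr_diff field_simps)
  ultimately show ?thesis by simp
qed

lemma gbinomial_abs_summable:
  fixes z :: real
  assumes "\<bar>z\<bar> < 1"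
  shows "summable (\<lambda>n. \<bar>(b gchoose n) * z ^ n\<bar>)"
proof -
  obtain y where y: "\<bar>z\<bar> < y" "y < 1" using dense[OF assms] by blast
  then have "summable (\<lambda>n. (b gchoose n) * y ^ n)"
    using gen_binomial_real[of y b] by (auto simp: sums_iff)
  from powser_insidea[OF this, of z] y show ?thesis by simp
qed

lemma AE_summable_if_integrals_summable:
  fixes f :: "nat \<Rightarrow> 'a \<Rightarrow> real"
  assumes int: "\<And>i. integrable M (f i)" and sum: "summable (\<lambda>i. \<integral>x. \<bar>f i x\<bar> \<partial>M)"
  shows "AE x in M. summable (\<lambda>i. \<bar>f i x\<bar>)"
proof -
  note [measurable] = borel_measurable_integrable[OF int]
  have "(\<integral>\<^sup>+x. (\<Sum>i. ennreal \<bar>f i x\<bar>) \<partial>M) = (\<Sum>i. \<integral>\<^sup>+x. ennreal \<bar>f i x\<bar> \<partial>M)"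
    by (intro nn_integral_suminf) auto
  also have "\<dots> = (\<Sum>i. ennreal (\<integral>x. \<bar>f i x\<bar> \<partial>M))"
    using int by (intro suminf_cong nn_integral_eq_integral) auto
  also have "\<dots> \<noteq> \<infinity>"
    unfolding infinity_ennreal_def by (rule ennreal_suminf_neq_top[OF sum]) simp
  finally have fin: "(\<integral>\<^sup>+x. (\<Sum>i. ennreal \<bar>f i x\<bar>) \<partial>M) \<noteq> \<infinity>" .
  have "AE x in M. (\<Sum>i. ennreal \<bar>f i x\<bar>) \<noteq> \<infinity>"
    by (rule nn_integral_PInf_AE[OF _ fin]) measurable
  then show ?thesis
    by eventually_elim (rule summable_suminf_not_top, simp_all)
qed

lemma has_bochner_integral_W_integral_kernel:
  assumes \<alpha>: "0 < \<alpha>" "\<alpha> < 1" and x: "0 < x" and small: "(1 - \<alpha>) * x powr (\<alpha> - 1) < 1"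
  shows "has_bochner_integral lborel
    (\<lambda>t. exp (- (x * t)) * (indicator {0<..} t * W_integral_kernel \<alpha> \<beta> t))
    (x powr (- \<alpha>) * (1 + (1 - \<alpha>) * x powr (\<alpha> - 1)) powr \<beta>)"
proof -
  define a where "a n = (1 - \<alpha>) * real n + \<alpha>" for n
  define p where "p n = pochhammer (- \<beta>) n / (fact n * Gamma (a n))" for n
  define f where "f n t = p n * (- (1 - \<alpha>)) ^ n *
    (indicator {0<..} t * (t powr (a n - 1) * exp (- (x * t))))" for n t
  define z where "z = (1 - \<alpha>) * x powr (\<alpha> - 1)"
  have z: "0 \<le> z" "z < 1" "\<bar>z\<bar> < 1"
    using \<alpha> x small by (auto simp: z_def)
  have a: "0 < a n" for n
    using \<alpha> by (simp add: a_def add_nonneg_pos)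
  have powr_a: "x powr (- a n) = x powr (- \<alpha>) * (x powr (\<alpha> - 1)) ^ n" for n
    using x by (simp add: a_def powr_realpow[symmetric] powr_powr powr_add[symmetric] algebra_simps)
  have coeff: "p n * (- (1 - \<alpha>)) ^ n * (Gamma (a n) / x powr a n) =
      x powr (- \<alpha>) * ((\<beta> gchoose n) * z ^ n)" for n
  proof -
    have "Gamma (a n) \<noteq> 0" using Gamma_real_pos[OF a] by (metis less_irrefl)
    then have "p n * (- (1 - \<alpha>)) ^ n * (Gamma (a n) / x powr a n) =
        pochhammer (- \<beta>) n / fact n * (- (1 - \<alpha>)) ^ n * x powr (- a n)"
      by (simp add: p_def powr_minus field_simps)
    also have "\<dots> = x powr (- \<alpha>) * ((\<beta> gchoose n) * z ^ n)"
      by (simp add: power_minus[of "1 - \<alpha>"] powr_a gbinomial_pochhammer z_def power_mult_distrib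
          del: minus_diff_eq)
    finally show ?thesis .
  qed
  have hb: "has_bochner_integral lborel (f n) (x powr (- \<alpha>) * ((\<beta> gchoose n) * z ^ n))" for n
    unfolding f_def coeff[symmetric]
    by (rule has_bochner_integral_mult_right) (rule has_bochner_integral_powr_exp[OF a x])
  have abs_f: "\<bar>f n t\<bar> = \<bar>p n * (- (1 - \<alpha>)) ^ n\<bar> *
      (indicator {0<..} t * (t powr (a n - 1) * exp (- (x * t))))" for n t
    by (simp add: f_def abs_mult)
  have norm_int: "(\<integral>t. \<bar>f n t\<bar> \<partial>lborel) = x powr (- \<alpha>) * \<bar>(\<beta> gchoose n) * z ^ n\<bar>" for n
  proof -
    have "(\<integral>t. \<bar>f n t\<bar> \<partial>lborel) = \<bar>p n * (- (1 - \<alpha>)) ^ n\<bar> * (Gamma (a n) / x powr a n)"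
      unfolding abs_f
      by (rule has_bochner_integral_integral_eq, rule has_bochner_integral_mult_right)
        (rule has_bochner_integral_powr_exp[OF a x])
    also have "\<dots> = \<bar>p n * (- (1 - \<alpha>)) ^ n * (Gamma (a n) / x powr a n)\<bar>"
      using Gamma_real_pos[OF a[of n]] by (simp add: abs_mult)
    finally show ?thesis
      unfolding coeff by (simp add: abs_mult)
  qed
  have sum: "summable (\<lambda>n. \<integral>t. \<bar>f n t\<bar> \<partial>lborel)"
    unfolding norm_int by (intro summable_mult gbinomial_abs_summable z)
  have int: "integrable lborel (f n)" for n
    using hb[of n] by (simp add: has_bochner_integral_iff)
  note AE = AE_summable_if_integrals_summable[OF int sum]
  have kernel: "(\<Sum>n. f n t) = exp (- (x * t)) * (indicator {0<..} t * W_integral_kernel \<alpha> \<beta> t)"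
    if summ: "summable (\<lambda>n. \<bar>f n t\<bar>)" for t
  proof (cases "t > 0")
    case True
    define c where "c = exp (- (x * t)) * t powr (\<alpha> - 1)"
    have "c \<noteq> 0" using True by (simp add: c_def)
    have pw: "t powr (a n - 1) = t powr (\<alpha> - 1) * (t powr (1 - \<alpha>)) ^ n" for n
      using True by (simp add: a_def powr_realpow[symmetric] powr_powr powr_add[symmetric] algebra_simps)
    have f_eq: "f n t = c * (p n * (- (1 - \<alpha>) * t powr (1 - \<alpha>)) ^ n)" for n
      unfolding f_def pw power_mult_distrib c_def using True by simp
    have "summable (\<lambda>n. f n t)"
      using summ by (rule summable_rabs_cancel)
    then have "summable (\<lambda>n. p n * (- (1 - \<alpha>) * t powr (1 - \<alpha>)) ^ n)"
      unfolding f_eq using \<open>c \<noteq> 0\<close> by (simp only: summable_cmult_iff) simp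
    then have "(\<Sum>n. f n t) = c * (\<Sum>n. p n * (- (1 - \<alpha>) * t powr (1 - \<alpha>)) ^ n)"
      unfolding f_eq by (rule suminf_mult)
    then show ?thesis
      using True by (simp add: W_integral_kernel_def prabhakar_def p_def a_def c_def)
  qed (simp add: f_def)
  have AE_eq: "AE t in lborel. (\<Sum>n. f n t) =
      exp (- (x * t)) * (indicator {0<..} t * W_integral_kernel \<alpha> \<beta> t)"
    using AE by eventually_elim (rule kernel)
  have meas: "(\<lambda>t. exp (- (x * t)) * (indicator {0<..} t * W_integral_kernel \<alpha> \<beta> t)) \<in> borel_measurable lborel"
    unfolding W_integral_kernel_def prabhakar_def by measurable
  have "(\<lambda>n. integral\<^sup>L lborel (f n)) sums (\<integral>t. (\<Sum>n. f n t) \<partial>lborel)"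
    using int AE sum by (intro sums_integral) simp_all
  moreover have "integral\<^sup>L lborel (f n) = x powr (- \<alpha>) * ((\<beta> gchoose n) * z ^ n)" for n
    using hb by (rule has_bochner_integral_integral_eq)
  moreover have "(\<lambda>n. x powr (- \<alpha>) * ((\<beta> gchoose n) * z ^ n)) sums (x powr (- \<alpha>) * (1 + z) powr \<beta>)"
    by (intro sums_mult gen_binomial_real z)
  ultimately have val: "(\<integral>t. (\<Sum>n. f n t) \<partial>lborel) = x powr (- \<alpha>) * (1 + z) powr \<beta>"
    using sums_unique2 by simp blast
  have int_suminf: "integrable lborel (\<lambda>t. \<Sum>n. f n t)"
    using int AE sum by (intro integrable_suminf) simp_all
  with val have "has_bochner_integral lborel (\<lambda>t. \<Sum>n. f n t) (x powr (- \<alpha>) * (1 + z) powr \<beta>)"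
    by (simp add: has_bochner_integral_iff)
  then show ?thesis
    unfolding z_def[symmetric]
    using has_bochner_integral_cong_AE[OF borel_measurable_integrable[OF int_suminf] meas AE_eq] by blast
qed

lemma integral_compose_exp_eq_0:
  fixes h :: "real \<Rightarrow> real"
  assumes h: "integrable lborel h" and h0: "\<And>t. t \<le> 0 \<Longrightarrow> h t = 0"
    and moments: "\<And>n::nat. (LINT t|lborel. exp (- (real n * t)) * h t) = 0"
    and \<phi>: "continuous_on UNIV \<phi>"
  shows "(LINT t|lborel. \<phi> (exp (- t)) * h t) = 0"
proof -
  have [measurable]: "h \<in> borel_measurable borel" "\<phi> \<in> borel_measurable borel"
    using h \<phi> by (auto dest: borel_measurable_integrable borel_measurable_continuous_onI)
  have cont_int: "integrable lborel (\<lambda>t. \<psi> (exp (- t)) * h t)" if \<psi>: "continuous_on UNIV \<psi>" for \<psi> :: "real \<Rightarrow> real"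
  proof -
    have [measurable]: "\<psi> \<in> borel_measurable borel"
      using \<psi> by (rule borel_measurable_continuous_onI)
    have "compact (\<psi> ` {0..1})"
      by (intro compact_continuous_image continuous_on_subset[OF \<psi>]) auto
    then obtain B where B: "\<And>y. y \<in> {0..1} \<Longrightarrow> norm (\<psi> y) \<le> B"
      using bounded_iff[of "\<psi> ` {0..1}"] compact_imp_bounded by blast
    show ?thesis
    proof (rule Bochner_Integration.integrable_bound)
      show "integrable lborel (\<lambda>t. B * h t)" using h by simp
      show "AE t in lborel. norm (\<psi> (exp (- t)) * h t) \<le> norm (B * h t)"
      proof (rule AE_I2)
        fix t :: real
        show "norm (\<psi> (exp (- t)) * h t) \<le> norm (B * h t)"
        proof (cases "t \<le> 0")
          case False
          then have "\<bar>\<psi> (exp (- t))\<bar> \<le> B" using B[of "exp (- t)"] by simp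
          then show ?thesis by (simp add: abs_mult mult_right_mono)
        qed (simp add: h0)
      qed
    qed measurable
  qed
  have poly: "(LINT t|lborel. g (exp (- t)) * h t) = 0" if g: "real_polynomial_function g" for g
  proof -
    obtain a n where gs: "g = (\<lambda>x. \<Sum>i\<le>n. a i * x ^ i)"
      using g real_polynomial_function_iff_sum[of g] by blast
    have pw: "exp (- t) ^ i = exp (- (real i * t))" for i and t :: real
      by (simp add: exp_of_nat_mult[symmetric])
    have int: "integrable lborel (\<lambda>t. exp (- (real i * t)) * h t)" for i :: nat
      using cont_int[of "\<lambda>x. x ^ i"] by (simp add: pw continuous_intros)
    have "(LINT t|lborel. g (exp (- t)) * h t) = (LINT t|lborel. (\<Sum>i\<le>n. a i * (exp (- (real i * t)) * h t)))"
      by (simp add: gs pw sum_distrib_right mult.assoc)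
    also have "\<dots> = (\<Sum>i\<le>n. a i * (LINT t|lborel. exp (- (real i * t)) * h t))"
      using int by (subst Bochner_Integration.integral_sum) auto
    finally show ?thesis
      by (simp add: moments)
  qed
  define C where "C = (LINT t|lborel. \<bar>h t\<bar>)"
  have C: "0 \<le> C" by (simp add: C_def)
  have le: "\<bar>LINT t|lborel. \<phi> (exp (- t)) * h t\<bar> \<le> e * C" if e: "e > 0" for e
  proof -
    obtain g where g: "real_polynomial_function g" "\<And>x. x \<in> {0..1} \<Longrightarrow> \<bar>\<phi> x - g x\<bar> < e"
      using Stone_Weierstrass_real_polynomial_function[of "{0..1}" \<phi> e] e continuous_on_subset[OF \<phi>]
      by auto
    have gc: "continuous_on UNIV g"
      using g(1) by (intro continuous_on_polymonial_function) (simp add: real_polynomial_function_eq)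
    have "(LINT t|lborel. \<phi> (exp (- t)) * h t) =
        (LINT t|lborel. \<phi> (exp (- t)) * h t) - (LINT t|lborel. g (exp (- t)) * h t)"
      using poly[OF g(1)] by simp
    also have "\<dots> = (LINT t|lborel. \<phi> (exp (- t)) * h t - g (exp (- t)) * h t)"
      by (intro Bochner_Integration.integral_diff[symmetric] cont_int \<phi> gc)
    also have "\<bar>\<dots>\<bar> \<le> (LINT t|lborel. e * \<bar>h t\<bar>)"
    proof (rule order_trans[OF integral_abs_bound integral_mono_AE])
      show "integrable lborel (\<lambda>t. \<bar>\<phi> (exp (- t)) * h t - g (exp (- t)) * h t\<bar>)"
        by (intro integrable_abs Bochner_Integration.integrable_diff cont_int \<phi> gc)
      show "AE t in lborel. \<bar>\<phi> (exp (- t)) * h t - g (exp (- t)) * h t\<bar> \<le> e * \<bar>h t\<bar>"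
      proof (rule AE_I2)
        fix t :: real
        show "\<bar>\<phi> (exp (- t)) * h t - g (exp (- t)) * h t\<bar> \<le> e * \<bar>h t\<bar>"
        proof (cases "t \<le> 0")
          case False
          then have "\<bar>\<phi> (exp (- t)) - g (exp (- t))\<bar> \<le> e"
            using g(2)[of "exp (- t)"] by simp
          then show ?thesis
            unfolding left_diff_distrib[symmetric] abs_mult by (rule mult_right_mono) simp
        qed (simp add: h0)
      qed
    qed (use h in simp)
    finally show ?thesis by (simp add: C_def)
  qed
  have "\<bar>LINT t|lborel. \<phi> (exp (- t)) * h t\<bar> \<le> 0 + e" if e: "e > 0" for e
  proof -
    have "\<bar>LINT t|lborel. \<phi> (exp (- t)) * h t\<bar> \<le> e / (C + 1) * C"
      using C e by (intro le) auto
    also have "\<dots> \<le> e"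
      using C e by (simp add: field_simps)
    finally show ?thesis by simp
  qed
  then have "\<bar>LINT t|lborel. \<phi> (exp (- t)) * h t\<bar> \<le> 0"
    by (rule field_le_epsilon)
  then show ?thesis by simp
qed

theorem AE_eq_0_if_exp_moments_eq_0:
  fixes h :: "real \<Rightarrow> real"
  assumes h: "integrable lborel h" and h0: "\<And>t. t \<le> 0 \<Longrightarrow> h t = 0"
    and moments: "\<And>n::nat. (LINT t|lborel. exp (- (real n * t)) * h t) = 0"
  shows "AE t in lborel. h t = 0"
proof -
  have [measurable]: "h \<in> borel_measurable borel"
    using h by (auto dest: borel_measurable_integrable)
  have I0: "(LINT t:{..b}|lborel. h t) = 0" for b
  proof -
    define \<phi> where "\<phi> m x = max 0 (min 1 (1 + real m * (x - exp (- b))))" for m x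
    have cont: "continuous_on UNIV (\<phi> m)" for m
      unfolding \<phi>_def by (intro continuous_intros)
    have [measurable]: "\<phi> m \<in> borel_measurable borel" for m
      by (rule borel_measurable_continuous_onI[OF cont])
    have "(\<lambda>m. LINT t|lborel. \<phi> m (exp (- t)) * h t) \<longlonglongrightarrow> (LINT t|lborel. indicator {..b} t * h t)"
    proof (rule integral_dominated_convergence)
      show "integrable lborel (\<lambda>t. \<bar>h t\<bar>)" using h by simp
      show "AE t in lborel. (\<lambda>m. \<phi> m (exp (- t)) * h t) \<longlonglongrightarrow> indicator {..b} t * h t"
      proof (intro AE_I2 tendsto_mult tendsto_const)
        fix t :: real
        show "(\<lambda>m. \<phi> m (exp (- t))) \<longlonglongrightarrow> indicator {..b} t"
        proof (cases "t \<le> b")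
          case True
          then show ?thesis by (simp add: \<phi>_def)
        next
          case False
          define d where "d = exp (- b) - exp (- t)"
          have d: "d > 0" using False by (simp add: d_def)
          have "\<forall>\<^sub>F m in sequentially. 1 / d \<le> real m"
            by (rule eventually_sequentiallyI[of "nat \<lceil>1 / d\<rceil>"]) linarith
          then have "\<forall>\<^sub>F m in sequentially. \<phi> m (exp (- t)) = 0"
          proof eventually_elim
            case (elim m)
            then have "1 \<le> real m * d" using d by (simp add: field_simps)
            moreover have "real m * (exp (- t) - exp (- b)) = - (real m * d)"
              by (simp add: d_def algebra_simps)
            ultimately show ?case by (simp add: \<phi>_def)
          qed
          then show ?thesis using False by (simp add: tendsto_eventually)
        qed
      qed
      show "AE t in lborel. norm (\<phi> m (exp (- t)) * h t) \<le> \<bar>h t\<bar>" for m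
        by (intro AE_I2) (auto simp: \<phi>_def abs_mult intro!: mult_left_le_one_le)
    qed measurable
    then have "(\<lambda>m::nat. 0::real) \<longlonglongrightarrow> (LINT t|lborel. indicator {..b} t * h t)"
      using integral_compose_exp_eq_0[OF h h0 moments cont] by simp
    then show ?thesis
      by (simp add: set_lebesgue_integral_def LIMSEQ_const_iff)
  qed
  have "AE t in lborel. \<forall>n::nat. t \<in> {- real n<..<real n} \<longrightarrow> h t = 0"
    unfolding AE_all_countable
    by (intro allI AE_eq_0_if_AE_set_integral_eq_0[OF h]) (simp add: I0)
  then show ?thesis
  proof eventually_elim
    case (elim t)
    obtain n where "\<bar>t\<bar> < real n" using reals_Archimedean2 by blast
    then have "t \<in> {- real n<..<real n}" by (simp add: abs_less_iff minus_less_iff)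
    with elim show ?case by blast
  qed
qed

lemma lborel_convolution_exp_mult:
  "lborel_convolution (\<lambda>t. exp (- (x * t)) * a t) (\<lambda>t. exp (- (x * t)) * b t) t =
    exp (- (x * t)) * lborel_convolution a b t" for a b :: "real \<Rightarrow> real"
proof -
  have eq: "exp (- (x * (t - s))) * a (t - s) * (exp (- (x * s)) * b s) = exp (- (x * t)) * (a (t - s) * b s)" for s
  proof -
    have "exp (- (x * (t - s))) * exp (- (x * s)) = exp (- (x * t))"
      by (simp add: exp_add[symmetric] algebra_simps)
    then show ?thesis by (simp add: mult_ac)
  qed
  show ?thesis
    unfolding lborel_convolution_def real_scaleR_def eq by simp
qed

lemma lborel_convolution_eq_0:
  assumes "\<And>t. t \<le> 0 \<Longrightarrow> a t = 0" "\<And>t. t \<le> 0 \<Longrightarrow> b t = 0" "t \<le> 0"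
  shows "lborel_convolution a b t = 0"
proof -
  have eq: "a (t - s) *\<^sub>R b s = 0" for s
    using assms by (cases "s \<le> 0") auto
  show ?thesis
    unfolding lborel_convolution_def eq by simp
qed

text \<open>The product of the Laplace transforms is \<open>1 / x\<close>, the transform of the constant \<open>1\<close>.\<close>

theorem lborel_convolution_eq_1_if_laplace:
  fixes a b :: "real \<Rightarrow> real"
  assumes a0: "\<And>t. t \<le> 0 \<Longrightarrow> a t = 0" and b0: "\<And>t. t \<le> 0 \<Longrightarrow> b t = 0" and x0: "0 < x0"
    and a: "\<And>x. x0 \<le> x \<Longrightarrow> has_bochner_integral lborel (\<lambda>t. exp (- (x * t)) * a t) (A x)"
    and b: "\<And>x. x0 \<le> x \<Longrightarrow> has_bochner_integral lborel (\<lambda>t. exp (- (x * t)) * b t) (B x)"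
    and AB: "\<And>x. x0 \<le> x \<Longrightarrow> A x * B x = 1 / x"
  shows "AE t in lborel. 0 < t \<longrightarrow> lborel_convolution a b t = 1"
proof -
  define c where "c t = lborel_convolution a b t - indicator {0<..} t" for t
  have laplace_c: "has_bochner_integral lborel (\<lambda>t. exp (- (x * t)) * c t) 0" if x: "x0 \<le> x" for x
  proof -
    have ab: "integrable lborel (\<lambda>t. exp (- (x * t)) * a t)" "integrable lborel (\<lambda>t. exp (- (x * t)) * b t)"
        "(LINT t|lborel. exp (- (x * t)) * a t) * (LINT t|lborel. exp (- (x * t)) * b t) = 1 / x"
      using a[OF x] b[OF x] AB[OF x] by (auto simp: has_bochner_integral_iff)
    have "has_bochner_integral lborel (\<lambda>t. exp (- (x * t)) * lborel_convolution a b t) (1 / x)"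
      using integrable_lborel_convolution[OF ab(1,2)] integral_lborel_convolution[OF ab(1,2)] ab(3)
      by (simp add: has_bochner_integral_iff lborel_convolution_exp_mult[abs_def])
    moreover have "has_bochner_integral lborel (\<lambda>t. exp (- (x * t)) * indicator {0<..} t) (1 / x)"
    proof -
      have "(\<lambda>t. indicator {0<..} t * (t powr (1 - 1) * exp (- (x * t)))) =
          (\<lambda>t. exp (- (x * t)) * indicator {0<..} t)"
        by (auto simp: fun_eq_iff indicator_def)
      then show ?thesis
        using has_bochner_integral_powr_exp[of 1 x] x x0 by simp
    qed
    ultimately have "has_bochner_integral lborel (\<lambda>t. exp (- (x * t)) * lborel_convolution a b t -
        exp (- (x * t)) * indicator {0<..} t) (1 / x - 1 / x)"
      by (rule has_bochner_integral_diff)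
    then show ?thesis
      by (simp add: c_def right_diff_distrib)
  qed
  have "AE t in lborel. exp (- (x0 * t)) * c t = 0"
  proof (rule AE_eq_0_if_exp_moments_eq_0)
    show "integrable lborel (\<lambda>t. exp (- (x0 * t)) * c t)"
      using laplace_c[of x0] by (simp add: has_bochner_integral_iff)
    show "exp (- (x0 * t)) * c t = 0" if "t \<le> 0" for t
      using lborel_convolution_eq_0[OF a0 b0 that] that by (simp add: c_def)
    fix n :: nat
    have eq: "exp (- (real n * t)) * (exp (- (x0 * t)) * c t) = exp (- ((x0 + real n) * t)) * c t" for t
      by (simp add: exp_add[symmetric] algebra_simps flip: mult.assoc)
    show "(LINT t|lborel. exp (- (real n * t)) * (exp (- (x0 * t)) * c t)) = 0"
      unfolding eq using laplace_c[of "x0 + real n"] by (simp add: has_bochner_integral_iff)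
  qed
  then show ?thesis
    by eventually_elim (auto simp: c_def)
qed

section \<open>The fractional derivative of the fractional integral\<close>

lemma borel_representative:
  fixes f :: "real \<Rightarrow> 'a::euclidean_space"
  assumes f: "set_integrable lebesgue S f" and S: "S \<in> sets borel"
  obtains f' where "integrable lborel f'" "\<And>x. x \<notin> S \<Longrightarrow> f' x = 0" "AE x in lborel. x \<in> S \<longrightarrow> f' x = f x"
proof -
  define F where "F = (\<lambda>x. indicator S x *\<^sub>R f x)"
  have F: "integrable lebesgue F"
    using f by (simp add: set_integrable_def F_def)
  then have "(\<lambda>x. F x \<bullet> b) \<in> borel_measurable lebesgue" for b
    by (intro borel_measurable_inner borel_measurable_const borel_measurable_integrable)
  then have "\<forall>b. \<exists>r\<in>borel_measurable lborel. AE x in lborel. F x \<bullet> b = r x"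
    using completion_ex_borel_measurable_real by blast
  then obtain r where r: "\<And>b. r b \<in> borel_measurable lborel" "\<And>b. AE x in lborel. F x \<bullet> b = r b x"
    by metis
  define f' where "f' x = indicator S x *\<^sub>R (\<Sum>b\<in>Basis. r b x *\<^sub>R b)" for x
  have [measurable]: "S \<in> sets borel" "\<And>b. r b \<in> borel_measurable borel"
    using S r(1) by simp_all
  have meas: "f' \<in> borel_measurable lborel"
    unfolding f'_def by measurable
  have "AE x in lborel. \<forall>b\<in>Basis. F x \<bullet> b = r b x"
    using r(2) by (intro AE_finite_allI) auto
  then have eq: "AE x in lborel. f' x = F x"
  proof eventually_elim
    case (elim x)
    then have "f' x = indicator S x *\<^sub>R (\<Sum>b\<in>Basis. (F x \<bullet> b) *\<^sub>R b)"
      by (simp add: f'_def)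
    also have "\<dots> = indicator S x *\<^sub>R F x"
      by (simp add: euclidean_representation)
    finally show ?case by (simp add: F_def indicator_def)
  qed
  have "AE x in lebesgue. F x = f' x"
    unfolding AE_completion_iff using eq by eventually_elim simp
  then have "integrable lebesgue f'"
    by (rule integrable_cong_AE_imp[OF F measurable_completion[OF meas]])
  then have "integrable lborel f'"
    using meas by (simp add: integrable_completion)
  moreover have "f' x = 0" if "x \<notin> S" for x
    using that by (simp add: f'_def)
  moreover have "AE x in lborel. x \<in> S \<longrightarrow> f' x = f x"
    using eq by eventually_elim (simp add: F_def)
  ultimately show thesis
    by (rule that)
qed

lemma half_line_convolution_eq_lborel_convolution:
  fixes f :: "real \<Rightarrow> 'a::euclidean_space"
  assumes a': "integrable lborel a'" "\<And>s. s \<notin> {0<..<T} \<Longrightarrow> a' s = 0"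
      "AE s in lborel. s \<in> {0<..<T} \<longrightarrow> a' s = a s"
    and f': "integrable lborel f'" "\<And>s. s \<notin> {0<..<T} \<Longrightarrow> f' s = 0"
      "AE s in lborel. s \<in> {0<..<T} \<longrightarrow> f' s = f s"
    and t: "t \<in> {0<..<T}"
  shows "half_line_convolution a f t = lborel_convolution a' f' t"
proof -
  have [measurable]: "a' \<in> borel_measurable borel" "f' \<in> borel_measurable borel"
    using a' f' by (auto dest: borel_measurable_integrable)
  have meas: "(\<lambda>s. a' (t - s) *\<^sub>R f' s) \<in> borel_measurable lborel"
    by measurable
  have "AE s in lborel. a' (t - s) *\<^sub>R f' s = indicator {0<..<t} s *\<^sub>R (a (t - s) *\<^sub>R f s)"
    using AE_lborel_reflect[OF a'(3), of t] f'(3)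
  proof eventually_elim
    case (elim s)
    show ?case
    proof (cases "s \<in> {0<..<t}")
      case False
      then have "s \<notin> {0<..<T} \<or> t - s \<notin> {0<..<T}" by auto
      then have "a' (t - s) *\<^sub>R f' s = 0" using a'(2) f'(2) by auto
      with False show ?thesis by simp
    qed (use elim t in auto)
  qed
  then have eq: "AE s in lebesgue. a' (t - s) *\<^sub>R f' s = indicator {0<..<t} s *\<^sub>R (a (t - s) *\<^sub>R f s)"
    by (simp add: AE_completion_iff)
  have "(LINT s|lebesgue. a' (t - s) *\<^sub>R f' s) =
      (LINT s|lebesgue. indicator {0<..<t} s *\<^sub>R (a (t - s) *\<^sub>R f s))"
    by (intro integral_cong_AE eq measurable_completion[OF meas]
        borel_measurable_AE[OF measurable_completion[OF meas] eq])
  then show ?thesis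
    using integral_completion[OF meas]
    by (simp add: half_line_convolution_def lborel_convolution_def set_lebesgue_integral_def)
qed

lemma W_symbol_of_real:
  assumes "0 < x" "\<alpha> < 1"
  shows "W_symbol \<alpha> \<beta> (of_real x) / of_real x =
    of_real (x powr (\<alpha> - 1) * (1 + (1 - \<alpha>) * x powr (\<alpha> - 1)) powr (- \<beta>))"
proof -
  have "complex_of_real x powr of_real \<alpha> = of_real (x powr \<alpha>)"
    "complex_of_real x powr of_real (\<alpha> - 1) = of_real (x powr (\<alpha> - 1))"
    using assms by (simp_all only: powr_of_real less_imp_le)
  moreover have "1 + of_real (1 - \<alpha>) * complex_of_real (x powr (\<alpha> - 1)) =
      of_real (1 + (1 - \<alpha>) * x powr (\<alpha> - 1))"
    by simp
  moreover have "complex_of_real (1 + (1 - \<alpha>) * x powr (\<alpha> - 1)) powr of_real (- \<beta>) =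
      of_real ((1 + (1 - \<alpha>) * x powr (\<alpha> - 1)) powr (- \<beta>))"
    using assms by (intro powr_of_real) simp
  ultimately have "W_symbol \<alpha> \<beta> (of_real x) =
      of_real (x powr \<alpha> * (1 + (1 - \<alpha>) * x powr (\<alpha> - 1)) powr (- \<beta>))"
    unfolding W_symbol_def by (simp only: of_real_mult)
  then show ?thesis
    using assms by (simp add: powr_diff)
qed

lemma W_derivative_kernel_representative:
  assumes w: "is_W_derivative_kernel \<alpha> \<beta> w" and \<alpha>: "\<alpha> < 1"
  obtains v where "v \<in> borel_measurable borel" "\<And>t. t \<le> 0 \<Longrightarrow> v t = 0"
    "AE t in lborel. 0 < t \<longrightarrow> v t = w t"
    "\<And>x. 0 < x \<Longrightarrow> has_bochner_integral lborel (\<lambda>t. exp (- (x * t)) * v t)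
       (x powr (\<alpha> - 1) * (1 + (1 - \<alpha>) * x powr (\<alpha> - 1)) powr (- \<beta>))"
proof -
  have laplace: "has_bochner_integral lebesgue (\<lambda>t. indicator {0<..} t * (exp (- (x * t)) * w t))
      (x powr (\<alpha> - 1) * (1 + (1 - \<alpha>) * x powr (\<alpha> - 1)) powr (- \<beta>))" if x: "0 < x" for x
  proof -
    let ?h = "\<lambda>t. indicator {0<..} t *\<^sub>R (exp (- (of_real x * complex_of_real t)) * of_real (w t))"
    have h: "?h t = of_real (indicator {0<..} t * (exp (- (x * t)) * w t))" for t
      by (simp add: exp_of_real[symmetric] indicator_def)
    have "has_bochner_integral lebesgue ?h (W_symbol \<alpha> \<beta> (of_real x) / of_real x)"
      using w x by (auto simp: is_W_derivative_kernel_def has_laplace_transform_def set_integrable_def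
          set_lebesgue_integral_def has_bochner_integral_iff)
    then have "has_bochner_integral lebesgue (\<lambda>t. complex_of_real (indicator {0<..} t * (exp (- (x * t)) * w t)))
        (of_real (x powr (\<alpha> - 1) * (1 + (1 - \<alpha>) * x powr (\<alpha> - 1)) powr (- \<beta>)))"
      unfolding h W_symbol_of_real[OF x \<alpha>] .
    then show ?thesis
      by (drule_tac has_bochner_integral_bounded_linear[OF bounded_linear_Re]) simp
  qed
  have "set_integrable lebesgue {0<..} (\<lambda>t. exp (- t) * w t)"
    using laplace[of 1] by (simp add: set_integrable_def has_bochner_integral_iff)
  then obtain g where g: "integrable lborel g" "\<And>t. t \<notin> {0<..} \<Longrightarrow> g t = 0"
      "AE t in lborel. t \<in> {0<..} \<longrightarrow> g t = exp (- t) * w t"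
    by (rule borel_representative) auto
  define v where "v t = exp t * g t" for t
  have [measurable]: "g \<in> borel_measurable borel"
    using g(1) by (auto dest: borel_measurable_integrable)
  have v[measurable]: "v \<in> borel_measurable borel"
    unfolding v_def by measurable
  have v0: "v t = 0" if "t \<le> 0" for t
    using g(2)[of t] that by (simp add: v_def)
  have vw: "AE t in lborel. 0 < t \<longrightarrow> v t = w t"
    using g(3) by eventually_elim (simp add: v_def exp_minus)
  have "has_bochner_integral lborel (\<lambda>t. exp (- (x * t)) * v t)
      (x powr (\<alpha> - 1) * (1 + (1 - \<alpha>) * x powr (\<alpha> - 1)) powr (- \<beta>))" if x: "0 < x" for x
  proof -
    have m: "(\<lambda>t. exp (- (x * t)) * v t) \<in> borel_measurable lborel"
      by measurable
    have eq: "AE t in lebesgue. exp (- (x * t)) * v t = indicator {0<..} t * (exp (- (x * t)) * w t)"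
      unfolding AE_completion_iff using vw
    proof eventually_elim
      case (elim t)
      then show ?case using v0[of t] by (cases "t > 0") auto
    qed
    have "has_bochner_integral lebesgue (\<lambda>t. exp (- (x * t)) * v t)
        (x powr (\<alpha> - 1) * (1 + (1 - \<alpha>) * x powr (\<alpha> - 1)) powr (- \<beta>))"
      using has_bochner_integral_cong_AE[OF measurable_completion[OF m]
          borel_measurable_AE[OF measurable_completion[OF m] eq] eq] laplace[OF x] by blast
    then show ?thesis
      using m by (simp add: has_bochner_integral_iff integrable_completion integral_completion)
  qed
  with v v0 vw show thesis by (rule that)
qed

lemma W_kernels_convolution:
  assumes \<alpha>: "0 < \<alpha>" "\<alpha> < 1" and v0: "\<And>t. t \<le> 0 \<Longrightarrow> v t = 0"
    and v: "\<And>x. 0 < x \<Longrightarrow> has_bochner_integral lborel (\<lambda>t. exp (- (x * t)) * v t)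
       (x powr (\<alpha> - 1) * (1 + (1 - \<alpha>) * x powr (\<alpha> - 1)) powr (- \<beta>))"
  shows "AE t in lborel. 0 < t \<longrightarrow>
    lborel_convolution v (\<lambda>t. indicator {0<..} t * W_integral_kernel \<alpha> \<beta> t) t = 1"
proof (rule lborel_convolution_eq_1_if_laplace[where ?x0.0=1])
  show "v t = 0" if "t \<le> 0" for t
    using that by (rule v0)
  show "indicator {0<..} t * W_integral_kernel \<alpha> \<beta> t = 0" if "t \<le> 0" for t
    using that by simp
next
  fix x :: real assume x: "1 \<le> x"
  show "has_bochner_integral lborel (\<lambda>t. exp (- (x * t)) * v t)
      (x powr (\<alpha> - 1) * (1 + (1 - \<alpha>) * x powr (\<alpha> - 1)) powr (- \<beta>))"
    using x by (intro v) simp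
  have "x powr (\<alpha> - 1) \<le> 1 powr (\<alpha> - 1)"
    using x \<alpha> by (intro powr_mono2') auto
  then have "(1 - \<alpha>) * x powr (\<alpha> - 1) \<le> (1 - \<alpha>) * 1"
    using \<alpha> by (intro mult_left_mono) auto
  also have "\<dots> < 1"
    using \<alpha> by simp
  finally show "has_bochner_integral lborel
      (\<lambda>t. exp (- (x * t)) * (indicator {0<..} t * W_integral_kernel \<alpha> \<beta> t))
      (x powr (- \<alpha>) * (1 + (1 - \<alpha>) * x powr (\<alpha> - 1)) powr \<beta>)"
    using x by (intro has_bochner_integral_W_integral_kernel \<alpha>) auto
  define y where "y = 1 + (1 - \<alpha>) * x powr (\<alpha> - 1)"
  have "0 < y" using \<alpha> x by (simp add: y_def add_pos_nonneg)
  then have "y powr (- \<beta>) * y powr \<beta> = 1"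
    by (simp flip: powr_add)
  moreover have "x powr (\<alpha> - 1) * x powr (- \<alpha>) = 1 / x"
    using x by (simp add: powr_neg_one flip: powr_add)
  ultimately show "x powr (\<alpha> - 1) * (1 + (1 - \<alpha>) * x powr (\<alpha> - 1)) powr (- \<beta>) *
      (x powr (- \<alpha>) * (1 + (1 - \<alpha>) * x powr (\<alpha> - 1)) powr \<beta>) = 1 / x"
    unfolding y_def[symmetric] by (metis (no_types) mult.assoc mult.commute mult_1)
qed simp

lemma integrable_truncation:
  fixes a :: "real \<Rightarrow> real"
  assumes "integrable lborel (\<lambda>t. exp (- t) * a t)"
  shows "integrable lborel (\<lambda>t. indicator {0<..<T} t * a t)"
proof (rule Bochner_Integration.integrable_bound)
  show "integrable lborel (\<lambda>t. exp T * (exp (- t) * a t))"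
    using assms by (rule integrable_mult_right)
  have "(\<lambda>t. exp t * (exp (- t) * a t)) \<in> borel_measurable lborel"
    by (rule borel_measurable_times[OF _ borel_measurable_integrable[OF assms]]) simp
  then have [measurable]: "a \<in> borel_measurable borel"
    by (simp add: mult.assoc[symmetric] exp_minus)
  show "(\<lambda>t. indicator {0<..<T} t * a t) \<in> borel_measurable lborel"
    by measurable
  show "AE t in lborel. norm (indicator {0<..<T} t * a t) \<le> norm (exp T * (exp (- t) * a t))"
  proof (rule AE_I2)
    fix t :: real
    have "exp T * exp (- t) \<ge> 1" if "t < T"
      using that by (simp flip: exp_add)
    then show "norm (indicator {0<..<T} t * a t) \<le> norm (exp T * (exp (- t) * a t))"
      using mult_right_mono[of 1 "exp T * exp (- t)" "\<bar>a t\<bar>"]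
      by (cases "t \<in> {0<..<T}") (auto simp: abs_mult)
  qed
qed

lemma lborel_convolution_indicator:
  assumes F0: "\<And>s. s \<le> 0 \<Longrightarrow> F s = 0" and F: "integrable lborel F" and t: "t < T"
  shows "lborel_convolution (indicator {0<..<T}) F t = (LINT s:{..t}|lborel. F s)"
  unfolding lborel_convolution_def set_lebesgue_integral_def
proof (rule integral_cong_AE)
  have [measurable]: "F \<in> borel_measurable borel"
    using F by (auto dest: borel_measurable_integrable)
  show "(\<lambda>s. indicator {0<..<T} (t - s) *\<^sub>R F s) \<in> borel_measurable lborel"
    "(\<lambda>s. indicator {..t} s *\<^sub>R F s) \<in> borel_measurable lborel"
    by measurable
  show "AE s in lborel. indicator {0<..<T} (t - s) *\<^sub>R F s = indicator {..t} s *\<^sub>R F s"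
    using AE_lborel_singleton[of t]
  proof eventually_elim
    case (elim s)
    then show ?case
      using F0[of s] t by (cases "s \<le> 0") (auto simp: indicator_def)
  qed
qed

lemma lborel_convolution_cong_AE:
  fixes F G :: "real \<Rightarrow> 'a::euclidean_space"
  assumes "integrable lborel a" "integrable lborel b" "integrable lborel F" "integrable lborel G"
    and a0: "\<And>s. s \<le> 0 \<Longrightarrow> a s = 0" and b0: "\<And>s. s \<le> 0 \<Longrightarrow> b s = 0"
    and F0: "\<And>s. s \<le> 0 \<Longrightarrow> F s = 0" and G0: "\<And>s. s \<le> 0 \<Longrightarrow> G s = 0"
    and ab: "AE s in lborel. s < T \<longrightarrow> a s = b s" and FG: "AE s in lborel. s < T \<longrightarrow> F s = G s"
    and t: "t < T"
  shows "lborel_convolution a F t = lborel_convolution b G t"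
  unfolding lborel_convolution_def
proof (rule integral_cong_AE)
  have [measurable]: "a \<in> borel_measurable borel" "b \<in> borel_measurable borel"
      "F \<in> borel_measurable borel" "G \<in> borel_measurable borel"
    using assms(1-4) by (auto dest: borel_measurable_integrable)
  show "(\<lambda>s. a (t - s) *\<^sub>R F s) \<in> borel_measurable lborel"
    "(\<lambda>s. b (t - s) *\<^sub>R G s) \<in> borel_measurable lborel"
    by measurable
  show "AE s in lborel. a (t - s) *\<^sub>R F s = b (t - s) *\<^sub>R G s"
    using AE_lborel_reflect[OF ab, of t] FG
  proof eventually_elim
    case (elim s)
    show ?case
    proof (cases "0 < s \<and> s < t")
      case False
      then have "s \<le> 0 \<or> t - s \<le> 0" by auto
      then show ?thesis using a0[of "t - s"] b0[of "t - s"] F0[of s] G0[of s] by auto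
    qed (use elim t in auto)
  qed
qed

lemma W_derivative_W_integral_AE_on_interval:
  fixes f u :: "real \<Rightarrow> 'a::euclidean_space"
  assumes \<alpha>: "0 < \<alpha>" "\<alpha> < 1" and w: "is_W_derivative_kernel \<alpha> \<beta> w" and f: "L1_loc f"
    and u: "AE t in lebesgue. 0 < t \<longrightarrow> u t = W_integral \<alpha> \<beta> f t"
    and ac: "locally_abs_continuous u" and u0: "u 0 = 0" and T: "0 < T"
  shows "AE t in lborel. t \<in> {0<..<T} \<longrightarrow> W_derivative w u t = f t"
proof -
  let ?I = "{0<..<T}"
  define one :: "real \<Rightarrow> real" where "one = indicator ?I"
  have one: "integrable lborel one" "\<And>s. s \<le> 0 \<Longrightarrow> one s = 0"
    unfolding one_def using T by (auto intro!: integrable_real_indicator)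
  obtain v where v: "v \<in> borel_measurable borel" "\<And>t. t \<le> 0 \<Longrightarrow> v t = 0"
      "AE t in lborel. 0 < t \<longrightarrow> v t = w t"
      "\<And>x. 0 < x \<Longrightarrow> has_bochner_integral lborel (\<lambda>t. exp (- (x * t)) * v t)
         (x powr (\<alpha> - 1) * (1 + (1 - \<alpha>) * x powr (\<alpha> - 1)) powr (- \<beta>))"
    by (rule W_derivative_kernel_representative[OF w \<alpha>(2)]) (rule that)
  define k where "k t = indicator {0<..} t * W_integral_kernel \<alpha> \<beta> t" for t
  define a where "a t = indicator ?I t * v t" for t
  define b where "b t = indicator ?I t * k t" for t
  have a: "integrable lborel a"
    unfolding a_def using v(4)[of 1] by (intro integrable_truncation) (simp add: has_bochner_integral_iff)
  have a0: "a s = 0" if "s \<notin> ?I" for s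
    using that by (simp add: a_def)
  have aw: "AE s in lborel. s \<in> ?I \<longrightarrow> a s = w s"
    using v(3) by eventually_elim (simp add: a_def)
  have "has_bochner_integral lborel (\<lambda>t. exp (- (1 * t)) * k t)
      (1 powr (- \<alpha>) * (1 + (1 - \<alpha>) * 1 powr (\<alpha> - 1)) powr \<beta>)"
    unfolding k_def using \<alpha> by (intro has_bochner_integral_W_integral_kernel) auto
  then have b: "integrable lborel b"
    unfolding b_def by (intro integrable_truncation) (simp add: has_bochner_integral_iff)
  have b0: "b s = 0" if "s \<notin> ?I" for s
    using that by (simp add: b_def)
  have bk: "AE s in lborel. s \<in> ?I \<longrightarrow> b s = W_integral_kernel \<alpha> \<beta> s"
    by (intro AE_I2) (simp add: b_def k_def)
  have ab: "lborel_convolution a b t = lborel_convolution v k t" if "t < T" for t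
  proof -
    have "a (t - s) *\<^sub>R b s = v (t - s) *\<^sub>R k s" for s
    proof (cases "0 < s \<and> s < t")
      case True
      then have "s \<in> ?I" "t - s \<in> ?I" using that by auto
      then show ?thesis by (simp add: a_def b_def)
    next
      case False
      then have "s \<le> 0 \<or> t - s \<le> 0" by auto
      then show ?thesis using v(2)[of "t - s"] by (auto simp: a_def b_def k_def)
    qed
    then show ?thesis by (simp add: lborel_convolution_def)
  qed
  have "AE t in lborel. 0 < t \<longrightarrow> lborel_convolution v k t = 1"
    unfolding k_def by (rule W_kernels_convolution[OF \<alpha> v(2,4)])
  then have ab_one: "AE t in lborel. t < T \<longrightarrow> lborel_convolution a b t = one t"
  proof eventually_elim
    case (elim t)
    show ?case
    proof
      assume "t < T"
      show "lborel_convolution a b t = one t"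
      proof (cases "0 < t")
        case True
        then show ?thesis
          using elim ab[OF \<open>t < T\<close>] \<open>t < T\<close> by (simp add: one_def)
      next
        case False
        then show ?thesis
          using lborel_convolution_eq_0[of a b t] a0 b0 by (simp add: one_def)
      qed
    qed
  qed
  obtain f' where f': "integrable lborel f'" "\<And>x. x \<notin> ?I \<Longrightarrow> f' x = 0"
      "AE x in lborel. x \<in> ?I \<longrightarrow> f' x = f x"
    by (rule borel_representative[of ?I f]) (use f T that in \<open>auto simp: L1_loc_def\<close>)
  obtain g where g: "integrable lborel g" "\<And>x. x \<notin> ?I \<Longrightarrow> g x = 0"
      "\<And>x. x \<in> {0..T} \<Longrightarrow> (LINT s:{..x}|lborel. g s) = u x"
      "AE x in lborel. x \<in> ?I \<longrightarrow> g x = vector_derivative u (at x)"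
    by (rule abs_continuous_derivative[OF ac[unfolded locally_abs_continuous_def, rule_format, OF T] T u0])
      (rule that)
  define p where "p = lborel_convolution a g"
  have p: "integrable lborel p"
    unfolding p_def by (rule integrable_lborel_convolution[OF a g(1)])
  have p0: "p s = 0" if "s \<le> 0" for s
    unfolding p_def using that a0 g(2) by (intro lborel_convolution_eq_0) auto
  note int = a b f'(1) g(1) one(1) p
  have convolution_0: "lborel_convolution c F s = 0"
    if "\<And>s. s \<notin> ?I \<Longrightarrow> c s = 0" "\<And>s. s \<notin> ?I \<Longrightarrow> F s = 0" "s \<le> 0" for c F s
    using that by (intro lborel_convolution_eq_0) auto
  have one_I: "one s = 0" if "s \<notin> ?I" for s
    using that by (simp add: one_def)
  have "AE t in lborel. t < T \<longrightarrow> lborel_convolution one g t = lborel_convolution b f' t"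
    using u[unfolded AE_completion_iff]
  proof eventually_elim
    case (elim t)
    show ?case
    proof
      assume "t < T"
      show "lborel_convolution one g t = lborel_convolution b f' t"
      proof (cases "0 < t")
        case True
        have "lborel_convolution one g t = u t"
          unfolding one_def using True \<open>t < T\<close> g(3)[of t]
          by (subst lborel_convolution_indicator) (auto intro: g)
        also have "\<dots> = half_line_convolution (W_integral_kernel \<alpha> \<beta>) f t"
          using elim True by (simp add: W_integral_def)
        also have "\<dots> = lborel_convolution b f' t"
          using True \<open>t < T\<close>
          by (intro half_line_convolution_eq_lborel_convolution[OF b b0 bk f']) auto
        finally show ?thesis .
      next
        case False
        then show ?thesis
          using convolution_0[OF one_I g(2)] convolution_0[OF b0 f'(2)] by simp
      qed
    qed
  qed
  then have step1: "lborel_convolution a (lborel_convolution one g) t =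
      lborel_convolution a (lborel_convolution b f') t" if "t < T" for t
    using that a0 convolution_0[OF one_I g(2)] convolution_0[OF b0 f'(2)]
    by (intro lborel_convolution_cong_AE[where T=T] integrable_lborel_convolution int) auto
  have step2: "lborel_convolution (lborel_convolution a b) f' t = lborel_convolution one f' t"
    if "t < T" for t
    using that ab_one f'(2) one(2) convolution_0[OF a0 b0]
    by (intro lborel_convolution_cong_AE[where T=T] integrable_lborel_convolution int) auto
  have "AE t in lborel. t \<in> ?I \<longrightarrow> (LINT s:{..t}|lborel. p s - f' s) = 0"
    using lborel_convolution_assoc[OF one(1) a g(1)] lborel_convolution_assoc[OF a one(1) g(1)]
      lborel_convolution_assoc[OF a b f'(1)]
  proof eventually_elim
    case (elim t)
    show ?case
    proof
      assume t: "t \<in> ?I"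
      have "(LINT s:{..t}|lborel. p s) = lborel_convolution one p t"
        unfolding one_def using t p p0 by (subst lborel_convolution_indicator) auto
      also have "\<dots> = lborel_convolution (lborel_convolution a one) g t"
        using elim(1) by (simp add: p_def lborel_convolution_commute[of one a])
      also have "\<dots> = lborel_convolution a (lborel_convolution b f') t"
        using elim(2) step1 t by simp
      also have "\<dots> = lborel_convolution one f' t"
        using elim(3) step2 t by simp
      also have "\<dots> = (LINT s:{..t}|lborel. f' s)"
        unfolding one_def using t f' by (subst lborel_convolution_indicator) auto
      finally have "(LINT s:{..t}|lborel. p s) = (LINT s:{..t}|lborel. f' s)" .
      moreover have "set_integrable lborel {..t} p" "set_integrable lborel {..t} f'"
        unfolding set_integrable_def using p f'(1) by (auto intro!: integrable_mult_indicator)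
      ultimately show "(LINT s:{..t}|lborel. p s - f' s) = 0"
        by (simp add: set_integral_diff)
    qed
  qed
  then have "AE t in lborel. t \<in> ?I \<longrightarrow> p t - f' t = 0"
    by (rule AE_eq_0_if_AE_set_integral_eq_0[OF Bochner_Integration.integrable_diff[OF p f'(1)]])
  with f'(3) show ?thesis
  proof eventually_elim
    case (elim t)
    have "W_derivative w u t = p t" if "t \<in> ?I"
      unfolding W_derivative_def p_def
      by (rule half_line_convolution_eq_lborel_convolution[OF a a0 aw g(1,2,4) that])
    with elim show ?case by auto
  qed
qed

theorem theorem4p10:
  fixes \<alpha> \<beta> :: real
    and w :: "real \<Rightarrow> real"
    and f u :: "real \<Rightarrow> 'a::euclidean_space"
  assumes "0 < \<alpha>" and "\<alpha> < 1" and "0 \<le> \<beta>"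
    and "is_W_derivative_kernel \<alpha> \<beta> w"
    and "L1_loc f"
    and "AE t in lebesgue. 0 < t \<longrightarrow> u t = W_integral \<alpha> \<beta> f t"
    and "locally_abs_continuous u"
    and "u 0 = 0"
  shows "AE t in lebesgue. 0 < t \<longrightarrow> W_derivative w u t = f t"
proof -
  have "AE t in lborel. \<forall>n::nat. t \<in> {0<..<real (Suc n)} \<longrightarrow> W_derivative w u t = f t"
    unfolding AE_all_countable using assms
    by (intro allI W_derivative_W_integral_AE_on_interval) auto
  then show ?thesis
    unfolding AE_completion_iff
  proof eventually_elim
    case (elim t)
    obtain n where "t < real n" using reals_Archimedean2 by blast
    then have "t < real (Suc n)" by simp
    with elim show ?case by auto
  qed
qed

end
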